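(* Let $N\in\mathbb{Z}_{>0}$, $A_k\in\mathbb{R}^{n\times n}$, $B_k\in\mathbb{R}^{n\times m}$ for $k=0,\dots,N-1$. Assume that $A_k$ is invertible for every $k\in\{0,\dots,N-1\}$ and that the reachability Gramian $G_{\rm r}(N,0)$ is invertible. Then for any $\bar x_0,\bar x_N\in\mathbb{R}^n$, the process $\{x_k^\bullet\}_{k=0}^N$ defined by $x_0^\bullet=\bar x_0$ a.s. and, for $k\in\{0,\dots,N-1\}$, $$x_{k+1}^\bullet=\widehat A_kx_k^\bullet+B_kB_k^\top\Phi(N,k+1)^\top G_{\rm r}(N,k)^\dagger\bar x_N+B_kw_k^\bullet,$$ where $$\widehat A_k:=\bigl(I-B_kB_k^\top\Phi(N,k+1)^\top G_{\rm r}(N,k)^\dagger\Phi(N,k+1)\bigr)A_k$$ and $\{w_k^\bullet\}$ is an independent sequence with $$w_k^\bullet\sim\mathcal N\bigl(0,\ I-B_k^\top\Phi(N,k+1)^\top G_{\rm r}(N,k)^\dagger\Phi(N,k+1)B_k\bigr),$$ is a pinned process from $\bar x_0$ to $\bar x_N$ associated to the noise-driven system $\widetilde x_{k+1}=A_k\widetilde x_k+B_kw_k$, $w_k\sim\mathcal N(0,I)$ with $\{w_k\}$ independent, $\widetilde x_0=\bar x_0$ a.s.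
   Context: For invertible $A_k$, the state-transition matrix is $\Phi(k,l)=A_{k-1}A_{k-2}\cdots A_l$ if $k>l$, $\Phi(k,k)=I$, and $\Phi(k,l)=A_k^{-1}A_{k+1}^{-1}\cdots A_{l-1}^{-1}$ if $k<l$. For $k_0<k_1$, the reachability Gramian is $G_{\rm r}(k_1,k_0)=\sum_{k=k_0}^{k_1-1}\Phi(k_1,k+1)B_kB_k^\top\Phi(k_1,k+1)^\top$. $M^\dagger$ is the Moore–Penrose inverse of $M$. $\mathcal N(\mu,\Sigma)$ is the Gaussian distribution with mean $\mu$ and (possibly singular) covariance $\Sigma$. Pinned process: a stochastic process $\{\chi_k\}_{k=0}^N$ is a pinned process associated to the noise-driven system $\widetilde x_{k+1}=A_k\widetilde x_k+B_kw_k$, $\widetilde x_0=\bar x_0$ a.s. (with $w_k\sim\mathcal N(0,I)$ independent), from $\bar x_0$ to $\bar x_N$, if the joint distribution of $\{\chi_k\}_{k=0}^N$ coincides with the conditional distribution of $\{\widetilde x_k\}_{k=0}^N$ given $\widetilde x_N=\bar x_N$ (the usual Gaussian conditional distribution). *)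

theory Defs
  imports "HOL-Probability.Probability"
begin

(* product_up A l d = A (l+d-1) ** ... ** A l *)
primrec product_up :: "(nat \<Rightarrow> real^'n^'n) \<Rightarrow> nat \<Rightarrow> nat \<Rightarrow> real^'n^'n" where
  "product_up A l 0 = mat 1"
| "product_up A l (Suc d) = A (l + d) ** product_up A l d"

(* product_inv A k d = matrix_inv (A k) ** ... ** matrix_inv (A (k+d-1)) *)
primrec product_inv :: "(nat \<Rightarrow> real^'n^'n) \<Rightarrow> nat \<Rightarrow> nat \<Rightarrow> real^'n^'n" where
  "product_inv A k 0 = mat 1"
| "product_inv A k (Suc d) = product_inv A k d ** matrix_inv (A (k + d))"

definition state_transition :: "(nat \<Rightarrow> real^'n^'n) \<Rightarrow> nat \<Rightarrow> nat \<Rightarrow> real^'n^'n" where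
  "state_transition A k l =
     (if l \<le> k then product_up A l (k - l) else product_inv A k (l - k))"

definition reach_gramian ::
    "(nat \<Rightarrow> real^'n^'n) \<Rightarrow> (nat \<Rightarrow> real^'m^'n) \<Rightarrow> nat \<Rightarrow> nat \<Rightarrow> real^'n^'n" where
  "reach_gramian A B k1 k0 =
     (\<Sum>k\<in>{k0..<k1}. state_transition A k1 (k + 1) ** B k ** transpose (B k)
                      ** transpose (state_transition A k1 (k + 1)))"

definition is_pseudo_inverse :: "real^'n^'m \<Rightarrow> real^'m^'n \<Rightarrow> bool" where
  "is_pseudo_inverse M X \<longleftrightarrow>
     M ** X ** M = M \<and> X ** M ** X = X \<and>
     transpose (M ** X) = M ** X \<and> transpose (X ** M) = X ** M"

(* The four Penrose conditions determine X uniquely, and every real matrix has such an X. *)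
definition pseudo_inverse :: "real^'n^'m \<Rightarrow> real^'m^'n" where
  "pseudo_inverse M = (THE X. is_pseudo_inverse M X)"

definition covariance_matrix :: "real^'n^'n \<Rightarrow> bool" where
  "covariance_matrix S \<longleftrightarrow> transpose S = S \<and> (\<forall>v. 0 \<le> v \<bullet> (S *v v))"

(* The characteristic function covers singular covariances, where there is no density. *)
definition gaussian_law :: "(real^'n) measure \<Rightarrow> real^'n \<Rightarrow> real^'n^'n \<Rightarrow> bool" where
  "gaussian_law P \<mu> S \<longleftrightarrow>
     prob_space P \<and> sets P = sets borel \<and>
     (\<forall>u. (CLINT x|P. iexp (u \<bullet> x)) =
        exp (\<i> * complex_of_real (u \<bullet> \<mu>) - complex_of_real (u \<bullet> (S *v u) / 2)))"

(* Joint Gaussian law of finitely many vectors: block means m k, block covariances C k l. *)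
definition joint_gaussian_law ::
    "nat set \<Rightarrow> (nat \<Rightarrow> real^'n) measure \<Rightarrow> (nat \<Rightarrow> real^'n) \<Rightarrow> (nat \<Rightarrow> nat \<Rightarrow> real^'n^'n) \<Rightarrow> bool"
  where
  "joint_gaussian_law I P m C \<longleftrightarrow>
     prob_space P \<and> sets P = sets (Pi\<^sub>M I (\<lambda>_. borel)) \<and>
     (\<forall>u. (CLINT x|P. iexp (\<Sum>k\<in>I. u k \<bullet> x k)) =
        exp (\<i> * complex_of_real (\<Sum>k\<in>I. u k \<bullet> m k)
             - complex_of_real ((\<Sum>k\<in>I. \<Sum>l\<in>I. u k \<bullet> (C k l *v u l)) / 2)))"

definition independent_gaussian_noise ::
    "'a measure \<Rightarrow> nat \<Rightarrow> (nat \<Rightarrow> real^'m^'m) \<Rightarrow> (nat \<Rightarrow> 'a \<Rightarrow> real^'m) \<Rightarrow> bool" where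
  "independent_gaussian_noise M N S w \<longleftrightarrow>
     prob_space.indep_vars M (\<lambda>_. borel) w {..<N} \<and>
     (\<forall>k<N. gaussian_law (distr M borel (w k)) 0 (S k))"

definition noise_driven ::
    "'a measure \<Rightarrow> nat \<Rightarrow> (nat \<Rightarrow> real^'n^'n) \<Rightarrow> (nat \<Rightarrow> real^'m^'n) \<Rightarrow> real^'n
       \<Rightarrow> (nat \<Rightarrow> 'a \<Rightarrow> real^'m) \<Rightarrow> (nat \<Rightarrow> 'a \<Rightarrow> real^'n) \<Rightarrow> bool" where
  "noise_driven M N A B x0 w x \<longleftrightarrow>
     prob_space M \<and>
     independent_gaussian_noise M N (\<lambda>_. mat 1) w \<and>
     (\<forall>k\<le>N. x k \<in> borel_measurable M) \<and>
     (AE \<omega> in M. x 0 \<omega> = x0) \<and>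
     (\<forall>k<N. AE \<omega> in M. x (Suc k) \<omega> = A k *v x k \<omega> + B k *v w k \<omega>)"

definition path_space :: "nat \<Rightarrow> (nat \<Rightarrow> real^'n) measure" where
  "path_space N = Pi\<^sub>M {..N} (\<lambda>_. borel)"

definition sample_path :: "nat \<Rightarrow> (nat \<Rightarrow> 'a \<Rightarrow> real^'n) \<Rightarrow> 'a \<Rightarrow> nat \<Rightarrow> real^'n" where
  "sample_path N x \<omega> = (\<lambda>k\<in>{..N}. x k \<omega>)"

definition cross_covariance ::
    "'a measure \<Rightarrow> ('a \<Rightarrow> real^'n) \<Rightarrow> ('a \<Rightarrow> real^'m) \<Rightarrow> real^'m^'n" where
  "cross_covariance M X Y =
     (\<chi> i j. LINT \<omega>|M. (X \<omega> - integral\<^sup>L M X) $ i * (Y \<omega> - integral\<^sup>L M Y) $ j)"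

definition regular_conditional_law ::
    "'a measure \<Rightarrow> 'b measure \<Rightarrow> ('a \<Rightarrow> 'b) \<Rightarrow> 'c measure \<Rightarrow> ('a \<Rightarrow> 'c) \<Rightarrow> ('c \<Rightarrow> 'b measure) \<Rightarrow> bool"
  where
  "regular_conditional_law M S X T Y \<kappa> \<longleftrightarrow>
     \<kappa> \<in> T \<rightarrow>\<^sub>M prob_algebra S \<and>
     (\<forall>E\<in>sets S. \<forall>F\<in>sets T.
        emeasure M {\<omega> \<in> space M. X \<omega> \<in> E \<and> Y \<omega> \<in> F} =
        (\<integral>\<^sup>+y\<in>F. emeasure (\<kappa> y) E \<partial>(distr M T Y)))"

(* A regular conditional law is determined only up to null sets of y.  The second conjunct
   selects the usual Gaussian version and thereby fixes \<kappa> y for every single y: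
   with C k l = Cov (x k, x l), mean  E (x k) + C k N C(N,N)^+ (y - E (x N))  and
   covariance  C k l - C k N C(N,N)^+ C N l. *)
definition gaussian_conditional_law ::
    "'a measure \<Rightarrow> nat \<Rightarrow> (nat \<Rightarrow> 'a \<Rightarrow> real^'n) \<Rightarrow> (real^'n \<Rightarrow> (nat \<Rightarrow> real^'n) measure) \<Rightarrow> bool"
  where
  "gaussian_conditional_law M N x \<kappa> \<longleftrightarrow>
     regular_conditional_law M (path_space N) (sample_path N x) borel (x N) \<kappa> \<and>
     (\<forall>y. joint_gaussian_law {..N} (\<kappa> y)
        (\<lambda>k. integral\<^sup>L M (x k) +
             (cross_covariance M (x k) (x N) ** pseudo_inverse (cross_covariance M (x N) (x N)))
               *v (y - integral\<^sup>L M (x N)))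
        (\<lambda>k l. cross_covariance M (x k) (x l) -
             cross_covariance M (x k) (x N) ** pseudo_inverse (cross_covariance M (x N) (x N))
               ** cross_covariance M (x N) (x l)))"

(* The process \<xi> on M' has as joint law the conditional law, given x N = y, of the
   process x on M. *)
definition pinned_process ::
    "nat \<Rightarrow> 'a measure \<Rightarrow> (nat \<Rightarrow> 'a \<Rightarrow> real^'n) \<Rightarrow> real^'n
       \<Rightarrow> 'b measure \<Rightarrow> (nat \<Rightarrow> 'b \<Rightarrow> real^'n) \<Rightarrow> bool" where
  "pinned_process N M x y M' \<xi> \<longleftrightarrow>
     (\<forall>k\<le>N. \<xi> k \<in> borel_measurable M') \<and>
     (\<exists>\<kappa>. gaussian_conditional_law M N x \<kappa> \<and> distr M' (path_space N) (sample_path N \<xi>) = \<kappa> y)"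

definition pinned_gain ::
    "(nat \<Rightarrow> real^'n^'n) \<Rightarrow> (nat \<Rightarrow> real^'m^'n) \<Rightarrow> nat \<Rightarrow> nat \<Rightarrow> real^'n^'m" where
  "pinned_gain A B N k =
     transpose (B k) ** transpose (state_transition A N (k + 1))
       ** pseudo_inverse (reach_gramian A B N k)"

definition A_hat ::
    "(nat \<Rightarrow> real^'n^'n) \<Rightarrow> (nat \<Rightarrow> real^'m^'n) \<Rightarrow> nat \<Rightarrow> nat \<Rightarrow> real^'n^'n" where
  "A_hat A B N k = (mat 1 - B k ** pinned_gain A B N k ** state_transition A N (k + 1)) ** A k"

definition pinned_noise_cov ::
    "(nat \<Rightarrow> real^'n^'n) \<Rightarrow> (nat \<Rightarrow> real^'m^'n) \<Rightarrow> nat \<Rightarrow> nat \<Rightarrow> real^'m^'m" where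
  "pinned_noise_cov A B N k =
     mat 1 - pinned_gain A B N k ** state_transition A N (k + 1) ** B k"

definition pinned_dynamics ::
    "'b measure \<Rightarrow> nat \<Rightarrow> (nat \<Rightarrow> real^'n^'n) \<Rightarrow> (nat \<Rightarrow> real^'m^'n) \<Rightarrow> real^'n \<Rightarrow> real^'n
       \<Rightarrow> (nat \<Rightarrow> 'b \<Rightarrow> real^'m) \<Rightarrow> (nat \<Rightarrow> 'b \<Rightarrow> real^'n) \<Rightarrow> bool" where
  "pinned_dynamics M N A B x0 xN w x \<longleftrightarrow>
     prob_space M \<and>
     independent_gaussian_noise M N (pinned_noise_cov A B N) w \<and>
     (\<forall>k\<le>N. x k \<in> borel_measurable M) \<and>
     (AE \<omega> in M. x 0 \<omega> = x0) \<and>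
     (\<forall>k<N. AE \<omega> in M. x (Suc k) \<omega> =
        A_hat A B N k *v x k \<omega> + (B k ** pinned_gain A B N k) *v xN + B k *v w k \<omega>)"

end

theory Submission
  imports Defs
begin

text \<open>In the coordinates \<open>\<Phi>(N,k) x\<^sub>k\<close> the free system is a random walk with increments
  \<open>C\<^sub>k w\<^sub>k\<close>, where \<open>C\<^sub>k = \<Phi>(N,k+1) B\<^sub>k\<close>, and \<open>G\<^sub>r(N,k) = C\<^sub>k C\<^sub>k\<^sup>T + G\<^sub>r(N,k+1)\<close>.
  With \<open>G\<^sub>k = G\<^sub>r(N,k)\<close>, the error \<open>e\<^sub>k = y - \<Phi>(N,k) x\<^sub>k\<close> of the pinned dynamics with
  prescribed final state \<open>y\<close> has mean
  \<open>G\<^sub>k G\<^sub>0\<^sup>-\<^sup>1 e\<^sub>0\<close> and covariances \<open>G\<^sub>k G\<^sub>0\<^sup>-\<^sup>1 (G\<^sub>0 - G\<^sub>l)\<close> for \<open>l \<le> k\<close>, which are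
  those of the Gaussian conditional law. The regular conditional law itself is the law of
  \<open>x\<^sub>k - K\<^sub>k (x\<^sub>N - y)\<close>, where \<open>K\<^sub>k\<close> is the regression matrix: the residual \<open>x\<^sub>k - K\<^sub>k x\<^sub>N\<close> is
  uncorrelated with \<open>x\<^sub>N\<close>, hence independent of it. Both the independence and the final identification of
  laws rest on the uniqueness theorem for characteristic functions of finitely many random vectors.\<close>

section \<open>Uniqueness of Fourier integrals\<close>

text \<open>Only \<open>G_0\<close> is known to be invertible; the Gramians \<open>G_k\<close> with
  k > 0 may lose rank, and \<open>G_N = 0\<close>. The pseudo-inverse in the feedback still acts
  like an inverse where it is needed: \<open>C_k C_k^T\<close> is a positive semidefinite summand of
  \<open>G_k\<close>, so the range of \<open>C_k\<close> lies in the range of \<open>G_k\<close>,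
  and \<open>G_k G_k^+ C_k = C_k\<close>. For the closed-loop matrix
  \<open>F_k = I - C_k C_k^T G_k^+\<close> this yields \<open>F_k G_k = G_(k+1)\<close>, the one
  identity that carries both the mean and the covariances. Hence the explicit kernel built from the
  regression residual. The Fourier uniqueness theorem is proved for complex weights
  \<open>f\<close>, not only for probability measures. A weight can absorb the factors belonging to
  the other random vectors, which allows one vector to be treated at a time.\<close>

lemma integrable_mult_bounded:
  fixes f g :: "'a \<Rightarrow> complex"
  assumes f: "integrable M f" and g: "g \<in> borel_measurable M" and b: "\<And>x. norm (g x) \<le> C"
  shows "integrable M (\<lambda>x. f x * g x)"
proof (rule Bochner_Integration.integrable_bound)
  show "integrable M (\<lambda>x. norm (f x) * C)" using f by simp
  show "(\<lambda>x. f x * g x) \<in> borel_measurable M" using f g by measurable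
  show "AE x in M. norm (f x * g x) \<le> norm (norm (f x) * C)"
    by (intro AE_I2) (simp add: norm_mult mult_left_mono order_trans[OF b abs_ge_self] abs_mult)
qed

lemma tendsto_integral_mult_bounded:
  fixes f :: "'a \<Rightarrow> complex" and g :: "nat \<Rightarrow> 'a \<Rightarrow> complex"
  assumes f: "integrable M f" and g: "\<And>n. g n \<in> borel_measurable M" and b: "\<And>n x. norm (g n x) \<le> C"
    and lim: "\<And>x. (\<lambda>n. g n x) \<longlonglongrightarrow> g' x"
  shows "(\<lambda>n. LINT x|M. f x * g n x) \<longlonglongrightarrow> (LINT x|M. f x * g' x)"
proof (rule integral_dominated_convergence[where w="\<lambda>x. norm (f x) * C"])
  have [measurable]: "f \<in> borel_measurable M" using f by simp
  note [measurable] = g borel_measurable_LIMSEQ_metric[OF g lim]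
  show "(\<lambda>x. f x * g' x) \<in> borel_measurable M" "(\<lambda>x. f x * g n x) \<in> borel_measurable M" for n
    by measurable
  show "AE x in M. (\<lambda>n. f x * g n x) \<longlonglongrightarrow> f x * g' x"
    by (intro AE_I2 tendsto_intros lim)
  show "AE x in M. norm (f x * g n x) \<le> norm (f x) * C" for n
    by (intro AE_I2) (simp add: norm_mult mult_left_mono b)
qed (use f in simp)

lemma norm_integral_mult_diff_le:
  fixes f g h :: "'a \<Rightarrow> complex"
  assumes f: "integrable M f" and [measurable]: "g \<in> borel_measurable M" "h \<in> borel_measurable M"
    and g: "\<And>x. norm (g x) \<le> C" and h: "\<And>x. norm (h x) \<le> D" and gh: "\<And>x. norm (g x - h x) \<le> e"
  shows "norm ((LINT x|M. f x * g x) - (LINT x|M. f x * h x)) \<le> e * (LINT x|M. norm (f x))"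
proof -
  have "(LINT x|M. f x * g x) - (LINT x|M. f x * h x) = (LINT x|M. f x * (g x - h x))"
    using Bochner_Integration.integral_diff[OF integrable_mult_bounded[OF f _ g] integrable_mult_bounded[OF f _ h]]
    by (simp add: right_diff_distrib)
  also have "norm \<dots> \<le> (LINT x|M. e * norm (f x))"
  proof (rule order_trans[OF integral_norm_bound integral_mono])
    show "integrable M (\<lambda>x. norm (f x * (g x - h x)))"
      by (intro integrable_norm integrable_mult_bounded[OF f _ gh]) simp
    show "norm (f x * (g x - h x)) \<le> e * norm (f x)" for x
      using mult_left_mono[OF gh norm_ge_zero] by (simp add: norm_mult mult.commute)
  qed (use f in simp)
  finally show ?thesis by simp
qed

text \<open>Dynkin's argument for the complex measures with densities \<open>f\<close> and
  \<open>f'\<close>, transported by \<open>X\<close> and \<open>Y\<close>. The total mass is a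
  separate hypothesis because the whole space need not belong to \<open>G\<close>; it serves the
  complement case.\<close>

lemma integral_indicator_eq_generator:
  fixes f :: "'a \<Rightarrow> complex" and f' :: "'b \<Rightarrow> complex"
  assumes S: "sets S = sigma_sets (space S) G" and G: "G \<subseteq> Pow (space S)" "Int_stable G"
    and X[measurable]: "X \<in> M \<rightarrow>\<^sub>M S" and Y[measurable]: "Y \<in> M' \<rightarrow>\<^sub>M S"
    and f: "integrable M f" and f': "integrable M' f'"
    and total: "integral\<^sup>L M f = integral\<^sup>L M' f'"
    and basic: "\<And>A. A \<in> G \<Longrightarrow> (LINT \<omega>|M. f \<omega> * indicator A (X \<omega>)) = (LINT \<omega>|M'. f' \<omega> * indicator A (Y \<omega>))"
    and A: "A \<in> sets S"
  shows "(LINT \<omega>|M. f \<omega> * indicator A (X \<omega>)) = (LINT \<omega>|M'. f' \<omega> * indicator A (Y \<omega>))"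
  using G(2,1) A[unfolded S]
proof (induction rule: sigma_sets_induct_disjoint)
  case (basic A)
  then show ?case by (rule assms)
next
  case empty
  then show ?case by simp
next
  case (compl A)
  then have [measurable]: "A \<in> sets S" by (simp add: S)
  have "(LINT \<omega>|M. f \<omega> * indicator (space S - A) (X \<omega>)) = (LINT \<omega>|M. f \<omega> - f \<omega> * indicator A (X \<omega>))"
    using measurable_space[OF X] by (intro Bochner_Integration.integral_cong) (auto simp: indicator_def)
  also have "\<dots> = integral\<^sup>L M f - (LINT \<omega>|M. f \<omega> * indicator A (X \<omega>))"
    by (intro Bochner_Integration.integral_diff f integrable_mult_bounded[where C=1])
       (auto simp: indicator_def)
  also have "\<dots> = integral\<^sup>L M' f' - (LINT \<omega>|M'. f' \<omega> * indicator A (Y \<omega>))"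
    using total compl by simp
  also have "\<dots> = (LINT \<omega>|M'. f' \<omega> - f' \<omega> * indicator A (Y \<omega>))"
    by (intro Bochner_Integration.integral_diff[symmetric] f' integrable_mult_bounded[where C=1])
       (auto simp: indicator_def)
  also have "\<dots> = (LINT \<omega>|M'. f' \<omega> * indicator (space S - A) (Y \<omega>))"
    using measurable_space[OF Y] by (intro Bochner_Integration.integral_cong) (auto simp: indicator_def)
  finally show ?case .
next
  case (union A)
  then have [measurable]: "A i \<in> sets S" for i by (auto simp: S)
  \<comment> \<open>Disjointness makes each partial sum an indicator again, which gives the uniform
    bound 1 for dominated convergence.\<close>
  have eq: "(\<Sum>i<n. indicator (A i) z) = (indicator (\<Union>i<n. A i) z :: complex)" for n z
    by (rule indicator_UN_disjoint[symmetric])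
       (use union in \<open>auto simp: disjoint_family_on_def\<close>)
  have lim: "(\<lambda>n. \<Sum>i<n. indicator (A i) z) \<longlonglongrightarrow> (indicator (\<Union>i. A i) z :: complex)" for z
    unfolding eq by (rule LIMSEQ_indicator_UN)
  have bound: "norm (\<Sum>i<n. indicator (A i) z :: complex) \<le> 1" for n z
    unfolding eq by (simp add: indicator_def)
  have sum: "(LINT \<omega>|M. f \<omega> * (\<Sum>i<n. indicator (A i) (X \<omega>))) = (\<Sum>i<n. LINT \<omega>|M. f \<omega> * indicator (A i) (X \<omega>))" for n
    unfolding sum_distrib_left
    by (intro Bochner_Integration.integral_sum integrable_mult_bounded[OF f, where C=1])
       (auto simp: indicator_def)
  have sum': "(LINT \<omega>|M'. f' \<omega> * (\<Sum>i<n. indicator (A i) (Y \<omega>))) = (\<Sum>i<n. LINT \<omega>|M'. f' \<omega> * indicator (A i) (Y \<omega>))" for n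
    unfolding sum_distrib_left
    by (intro Bochner_Integration.integral_sum integrable_mult_bounded[OF f', where C=1])
       (auto simp: indicator_def)
  have "(\<lambda>n. LINT \<omega>|M. f \<omega> * (\<Sum>i<n. indicator (A i) (X \<omega>))) \<longlonglongrightarrow> (LINT \<omega>|M. f \<omega> * indicator (\<Union>i. A i) (X \<omega>))"
    by (rule tendsto_integral_mult_bounded[OF f _ bound lim]) measurable
  moreover have "(\<lambda>n. LINT \<omega>|M'. f' \<omega> * (\<Sum>i<n. indicator (A i) (Y \<omega>))) \<longlonglongrightarrow> (LINT \<omega>|M'. f' \<omega> * indicator (\<Union>i. A i) (Y \<omega>))"
    by (rule tendsto_integral_mult_bounded[OF f' _ bound lim]) measurable
  ultimately show ?case
    unfolding sum sum' union.IH by (rule LIMSEQ_unique)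
qed

text \<open>Polynomials in the bounded functions \<open>n sin (x\<^sub>b / n)\<close> are trigonometric polynomials, so their
  integrals are determined by the Fourier integrals; Weierstrass approximation on a ball extends this to
  continuous functions of \<open>scaled_sin n x\<close>, and \<open>scaled_sin n x\<close> tends to \<open>x\<close>.\<close>

definition scaled_sin :: "nat \<Rightarrow> 'e::euclidean_space \<Rightarrow> 'e" where
  "scaled_sin n x = (\<Sum>b\<in>Basis. (real n * sin (x \<bullet> b / real n)) *\<^sub>R b)"

lemma scaled_sin_tendsto: "(\<lambda>n. scaled_sin n x) \<longlonglongrightarrow> x"
proof -
  have "(\<lambda>n. real n * sin (t / real n)) \<longlonglongrightarrow> t" for t
  proof (cases "t = 0")
    case False
    have "((\<lambda>s. sin s / s) \<longlongrightarrow> 1) (at (0::real))"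
      using DERIV_sin[of 0] by (simp add: has_field_derivative_iff)
    moreover have "filterlim (\<lambda>n. t / real n) (at 0) sequentially"
      unfolding filterlim_at using False
      by (auto intro!: tendsto_divide_0[OF tendsto_const] filterlim_at_top_imp_at_infinity
            filterlim_real_sequentially eventually_sequentiallyI[of 1])
    ultimately have "(\<lambda>n. t * (sin (t / real n) / (t / real n))) \<longlonglongrightarrow> t * 1"
      by (intro tendsto_mult tendsto_const) (rule filterlim_compose)
    then show ?thesis using False by (simp add: mult.commute)
  qed simp
  then have "(\<lambda>n. scaled_sin n x) \<longlonglongrightarrow> (\<Sum>b\<in>Basis. (x \<bullet> b) *\<^sub>R b)"
    unfolding scaled_sin_def by (intro tendsto_sum tendsto_scaleR tendsto_const)
  then show ?thesis by (simp add: euclidean_representation)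
qed

text \<open>For fixed \<open>n\<close> the bound is uniform in \<open>x\<close>, so approximation on
  a single compact ball controls the integrand everywhere and no tail estimate is needed.\<close>

lemma scaled_sin_in_cball: "scaled_sin n x \<in> cball 0 (real n * real DIM('e))" for x :: "'e::euclidean_space"
proof -
  have "norm (scaled_sin n x) \<le> (\<Sum>b\<in>Basis. \<bar>scaled_sin n x \<bullet> b\<bar>)" by (rule norm_le_l1)
  also have "\<dots> = (\<Sum>b\<in>(Basis :: 'e set). real n * \<bar>sin (x \<bullet> b / real n)\<bar>)"
    by (simp add: scaled_sin_def abs_mult)
  also have "\<dots> \<le> (\<Sum>b\<in>(Basis :: 'e set). real n * 1)"
    by (intro sum_mono mult_left_mono) auto
  finally show ?thesis by (simp add: mult.commute)
qed

lemma scaled_sin_measurable [measurable]: "scaled_sin n \<in> borel_measurable borel"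
  unfolding scaled_sin_def[abs_def] by measurable

text \<open>Euler's formula, written with sums, products and constants only, since these are the
  operations under which \<open>multiplier\<close> is shown to be closed.\<close>

lemma sin_iexp: "complex_of_real (sin t) = (iexp t + - 1 * iexp (- t)) * (1 / (2 * \<i>))"
proof -
  have "iexp t + - 1 * iexp (- t) = 2 * \<i> * complex_of_real (sin t)"
    unfolding cis_conv_exp[symmetric] by (simp add: complex_eq_iff)
  then show ?thesis by (simp add: mult.commute)
qed

text \<open>The weights are there to carry factors of other random variables: the locale is later
  instantiated with weights that contain characters of the remaining coordinates or of the
  regression residual.\<close>

locale equal_fourier_integrals =
  fixes M :: "'a measure" and M' :: "'b measure" and f :: "'a \<Rightarrow> complex" and f' :: "'b \<Rightarrow> complex"
    and X :: "'a \<Rightarrow> 'e::euclidean_space" and Y :: "'b \<Rightarrow> 'e"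
  assumes f: "integrable M f" and f': "integrable M' f'"
    and X [measurable]: "X \<in> borel_measurable M" and Y [measurable]: "Y \<in> borel_measurable M'"
    and fourier: "\<And>u. (CLINT \<omega>|M. f \<omega> * iexp (u \<bullet> X \<omega>)) = (CLINT \<omega>|M'. f' \<omega> * iexp (u \<bullet> Y \<omega>))"
begin

text \<open>Equality is demanded for every frequency \<open>u\<close>, not just for
  \<open>u = 0\<close>, so that multiplication by a character merely shifts
  \<open>u\<close>.\<close>

definition admissible :: "('e \<Rightarrow> complex) \<Rightarrow> bool" where
  "admissible p \<longleftrightarrow> p \<in> borel_measurable borel \<and> (\<exists>C. \<forall>x. norm (p x) \<le> C) \<and>
    (\<forall>u. (CLINT \<omega>|M. f \<omega> * (p (X \<omega>) * iexp (u \<bullet> X \<omega>))) = (CLINT \<omega>|M'. f' \<omega> * (p (Y \<omega>) * iexp (u \<bullet> Y \<omega>))))"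

text \<open>Admissible functions are closed under sums but not evidently under products. Multipliers
  are closed under both, products being composition, so polynomials of multipliers are
  multipliers.\<close>

definition multiplier :: "('e \<Rightarrow> complex) \<Rightarrow> bool" where
  "multiplier p \<longleftrightarrow> (\<forall>g. admissible g \<longrightarrow> admissible (\<lambda>x. p x * g x))"

lemma admissible_one: "admissible (\<lambda>_. 1)"
  unfolding admissible_def
proof (intro conjI allI exI)
  show "norm (1::complex) \<le> 1" by simp
  show "(CLINT \<omega>|M. f \<omega> * (1 * iexp (u \<bullet> X \<omega>))) = (CLINT \<omega>|M'. f' \<omega> * (1 * iexp (u \<bullet> Y \<omega>)))" for u
    unfolding mult_1 by (rule fourier)
qed simp

lemma multiplier_const: "multiplier (\<lambda>_. c)"
proof -
  have "admissible (\<lambda>x. c * g x)" if "admissible g" for g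
  proof -
    have [measurable]: "g \<in> borel_measurable borel" using that by (simp add: admissible_def)
    from that obtain C where C: "\<And>x. norm (g x) \<le> C" unfolding admissible_def by blast
    have eq: "a * (c * p * q) = c * (a * (p * q))" for a p q :: complex by simp
    show ?thesis unfolding admissible_def eq
    proof (intro conjI allI exI)
      show "norm (c * g x) \<le> norm c * C" for x by (simp add: norm_mult mult_left_mono C)
      show "(CLINT \<omega>|M. c * (f \<omega> * (g (X \<omega>) * iexp (u \<bullet> X \<omega>)))) =
          (CLINT \<omega>|M'. c * (f' \<omega> * (g (Y \<omega>) * iexp (u \<bullet> Y \<omega>))))" for u
        using that by (simp add: admissible_def)
    qed measurable
  qed
  then show ?thesis by (simp add: multiplier_def)
qed

lemma multiplier_iexp: "multiplier (\<lambda>x. iexp (v \<bullet> x))"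
proof -
  have "admissible (\<lambda>x. iexp (v \<bullet> x) * g x)" if "admissible g" for g
  proof -
    have [measurable]: "g \<in> borel_measurable borel" using that by (simp add: admissible_def)
    have eq: "iexp (v \<bullet> x) * p * iexp (u \<bullet> x) = p * iexp ((u + v) \<bullet> x)" for u x and p :: complex
      by (simp add: inner_add_left exp_add ring_distribs)
    from that obtain C where C: "\<And>x. norm (g x) \<le> C" unfolding admissible_def by blast
    show ?thesis unfolding admissible_def eq
    proof (intro conjI allI exI)
      show "norm (iexp (v \<bullet> x) * g x) \<le> C" for x by (simp add: norm_mult C)
      show "(CLINT \<omega>|M. f \<omega> * (g (X \<omega>) * iexp ((u + v) \<bullet> X \<omega>))) =
          (CLINT \<omega>|M'. f' \<omega> * (g (Y \<omega>) * iexp ((u + v) \<bullet> Y \<omega>)))" for u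
        using that by (simp add: admissible_def)
    qed measurable
  qed
  then show ?thesis by (simp add: multiplier_def)
qed

lemma multiplier_mult: "multiplier p \<Longrightarrow> multiplier q \<Longrightarrow> multiplier (\<lambda>x. p x * q x)"
  unfolding multiplier_def mult.assoc by blast

lemma admissible_add:
  assumes p: "admissible p" and q: "admissible q"
  shows "admissible (\<lambda>x. p x + q x)"
proof -
  have [measurable]: "p \<in> borel_measurable borel" "q \<in> borel_measurable borel"
    using p[unfolded admissible_def, THEN conjunct1] q[unfolded admissible_def, THEN conjunct1] .
  from p obtain C where C: "\<And>x. norm (p x) \<le> C" unfolding admissible_def by blast
  from q obtain D where D: "\<And>x. norm (q x) \<le> D" unfolding admissible_def by blast
  have int: "integrable M (\<lambda>\<omega>. f \<omega> * (p (X \<omega>) * iexp (u \<bullet> X \<omega>)))"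
    "integrable M' (\<lambda>\<omega>. f' \<omega> * (p (Y \<omega>) * iexp (u \<bullet> Y \<omega>)))"
    "integrable M (\<lambda>\<omega>. f \<omega> * (q (X \<omega>) * iexp (u \<bullet> X \<omega>)))"
    "integrable M' (\<lambda>\<omega>. f' \<omega> * (q (Y \<omega>) * iexp (u \<bullet> Y \<omega>)))" for u
    by (rule integrable_mult_bounded[OF f, where C=C] integrable_mult_bounded[OF f', where C=C]
         integrable_mult_bounded[OF f, where C=D] integrable_mult_bounded[OF f', where C=D];
        simp add: norm_mult C D; fail)+
  have eq: "(CLINT \<omega>|M. f \<omega> * (p (X \<omega>) * iexp (u \<bullet> X \<omega>))) = (CLINT \<omega>|M'. f' \<omega> * (p (Y \<omega>) * iexp (u \<bullet> Y \<omega>)))"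
    "(CLINT \<omega>|M. f \<omega> * (q (X \<omega>) * iexp (u \<bullet> X \<omega>))) = (CLINT \<omega>|M'. f' \<omega> * (q (Y \<omega>) * iexp (u \<bullet> Y \<omega>)))" for u
    using p[unfolded admissible_def, THEN conjunct2, THEN conjunct2, rule_format]
      q[unfolded admissible_def, THEN conjunct2, THEN conjunct2, rule_format] .
  show ?thesis unfolding admissible_def
  proof (intro conjI allI exI)
    show "norm (p x + q x) \<le> C + D" for x
      by (rule norm_triangle_le) (rule add_mono[OF C D])
    show "(CLINT \<omega>|M. f \<omega> * ((p (X \<omega>) + q (X \<omega>)) * iexp (u \<bullet> X \<omega>))) =
       (CLINT \<omega>|M'. f' \<omega> * ((p (Y \<omega>) + q (Y \<omega>)) * iexp (u \<bullet> Y \<omega>)))" for u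
      using Bochner_Integration.integral_add[OF int(1,3)[of u]] Bochner_Integration.integral_add[OF int(2,4)[of u]]
      unfolding eq by (simp only: distrib_left distrib_right)
  qed simp
qed

lemma multiplier_add: "multiplier p \<Longrightarrow> multiplier q \<Longrightarrow> multiplier (\<lambda>x. p x + q x)"
  unfolding multiplier_def distrib_right using admissible_add by presburger

lemma multiplier_sum:
  "finite I \<Longrightarrow> (\<And>i. i \<in> I \<Longrightarrow> multiplier (p i)) \<Longrightarrow> multiplier (\<lambda>x. \<Sum>i\<in>I. p i x)"
proof (induction I rule: finite_induct)
  case empty
  show ?case unfolding sum.empty by (rule multiplier_const)
next
  case (insert i I)
  have "multiplier (\<lambda>x. p i x + (\<Sum>i\<in>I. p i x))"
    by (rule multiplier_add[OF insert.prems insert.IH]) (auto intro: insert.prems)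
  then show ?case using insert.hyps by simp
qed

lemma multiplier_polynomial_scaled_sin:
  "real_polynomial_function q \<Longrightarrow> multiplier (\<lambda>x. complex_of_real (q (scaled_sin n x)))"
proof (induction rule: real_polynomial_function.induct)
  case (linear q)
  interpret q: bounded_linear q by fact
  \<comment> \<open>By linearity only the values \<open>q b\<close> on the basis matter, and each
    coordinate sine is a combination of two characters with opposite frequencies.\<close>
  have eq: "complex_of_real (q (scaled_sin n x)) =
     (\<Sum>b\<in>Basis. complex_of_real (q b * real n / 2) *
        ((iexp ((b /\<^sub>R real n) \<bullet> x) + - 1 * iexp ((- b /\<^sub>R real n) \<bullet> x)) * (1 / \<i>)))" for x
  proof -
    have "complex_of_real (q ((real n * sin (x \<bullet> b / real n)) *\<^sub>R b)) =
     complex_of_real (q b * real n / 2) *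
        ((iexp ((b /\<^sub>R real n) \<bullet> x) + - 1 * iexp ((- b /\<^sub>R real n) \<bullet> x)) * (1 / \<i>))" for b
    proof -
      have t: "(b /\<^sub>R real n) \<bullet> x = x \<bullet> b / real n" "(- b /\<^sub>R real n) \<bullet> x = - (x \<bullet> b / real n)"
        by (simp_all add: inner_commute[of b] divide_inverse)
      have half: "complex_of_real r * (z * (1 / (2 * \<i>))) = complex_of_real (r / 2) * (z * (1 / \<i>))" for r z
        by simp
      then show ?thesis
        unfolding t half[symmetric] sin_iexp[symmetric] by (simp add: q.scaleR)
    qed
    then show ?thesis unfolding scaled_sin_def q.sum of_real_sum by simp
  qed
  have "multiplier (\<lambda>x. iexp ((b /\<^sub>R real n) \<bullet> x) + - 1 * iexp ((- b /\<^sub>R real n) \<bullet> x))" for b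
    by (rule multiplier_add[OF multiplier_iexp multiplier_mult[OF multiplier_const multiplier_iexp]])
  from multiplier_mult[OF multiplier_const multiplier_mult[OF this multiplier_const]]
  show ?case unfolding eq by (intro multiplier_sum finite_Basis)
next
  case (const c)
  then show ?case by (rule multiplier_const)
next
  case (add p q)
  from multiplier_add[OF add.IH] show ?case by simp
next
  case (mult p q)
  from multiplier_mult[OF mult.IH] show ?case by simp
qed

lemma integral_polynomial_scaled_sin:
  assumes "real_polynomial_function q"
  shows "(CLINT \<omega>|M. f \<omega> * complex_of_real (q (scaled_sin n (X \<omega>)))) =
         (CLINT \<omega>|M'. f' \<omega> * complex_of_real (q (scaled_sin n (Y \<omega>))))"
    and "(\<lambda>x. complex_of_real (q (scaled_sin n x))) \<in> borel_measurable borel"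
    and "\<exists>C. \<forall>x. norm (complex_of_real (q (scaled_sin n x))) \<le> C"
proof -
  have "admissible (\<lambda>x. complex_of_real (q (scaled_sin n x)) * 1)"
    using multiplier_polynomial_scaled_sin[OF assms] admissible_one unfolding multiplier_def by blast
  then have *: "admissible (\<lambda>x. complex_of_real (q (scaled_sin n x)))" by simp
  then show "(\<lambda>x. complex_of_real (q (scaled_sin n x))) \<in> borel_measurable borel"
    and "\<exists>C. \<forall>x. norm (complex_of_real (q (scaled_sin n x))) \<le> C"
    unfolding admissible_def by blast+
  from * have "(CLINT \<omega>|M. f \<omega> * (complex_of_real (q (scaled_sin n (X \<omega>))) * iexp (0 \<bullet> X \<omega>))) =
         (CLINT \<omega>|M'. f' \<omega> * (complex_of_real (q (scaled_sin n (Y \<omega>))) * iexp (0 \<bullet> Y \<omega>)))"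
    unfolding admissible_def by blast
  then show "(CLINT \<omega>|M. f \<omega> * complex_of_real (q (scaled_sin n (X \<omega>)))) =
         (CLINT \<omega>|M'. f' \<omega> * complex_of_real (q (scaled_sin n (Y \<omega>))))" by simp
qed

lemma integral_continuous_scaled_sin:
  fixes h :: "'e \<Rightarrow> real"
  assumes h: "continuous_on UNIV h" and bound: "\<And>x. \<bar>h x\<bar> \<le> C"
  shows "(CLINT \<omega>|M. f \<omega> * complex_of_real (h (scaled_sin n (X \<omega>)))) =
         (CLINT \<omega>|M'. f' \<omega> * complex_of_real (h (scaled_sin n (Y \<omega>))))" (is "?L = ?R")
proof -
  have [measurable]: "h \<in> borel_measurable borel" by (rule borel_measurable_continuous_onI[OF h])
  \<comment> \<open>The total mass of both weights: a uniform error \<open>e\<close> in the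
    integrand changes the difference of the two integrals by at most \<open>e * K\<close>.\<close>
  define K where "K = (LINT \<omega>|M. norm (f \<omega>)) + (LINT \<omega>|M'. norm (f' \<omega>))"
  have K0: "0 \<le> K" unfolding K_def by (intro add_nonneg_nonneg integral_nonneg_AE) auto
  have approx: "norm (?L - ?R) \<le> e * K" if e: "0 < e" for e
  proof -
    let ?S = "cball 0 (real n * real DIM('e)) :: 'e set"
    obtain q where q: "real_polynomial_function q" and "\<And>x. x \<in> ?S \<Longrightarrow> \<bar>h x - q x\<bar> < e"
      using Stone_Weierstrass_real_polynomial_function[OF compact_cball continuous_on_subset[OF h subset_UNIV] e]
      by blast
    then have hq: "\<bar>h (scaled_sin n x) - q (scaled_sin n x)\<bar> \<le> e" for x
      using scaled_sin_in_cball less_imp_le by blast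
    note q' = integral_polynomial_scaled_sin[OF q, of n]
    note [measurable] = q'(2)
    from q'(3) obtain D where D: "\<And>x. norm (complex_of_real (q (scaled_sin n x))) \<le> D" by blast
    have "norm ((CLINT \<omega>|M. f \<omega> * complex_of_real (h (scaled_sin n (X \<omega>)))) -
          (CLINT \<omega>|M. f \<omega> * complex_of_real (q (scaled_sin n (X \<omega>))))) \<le> e * (LINT \<omega>|M. norm (f \<omega>))"
      by (rule norm_integral_mult_diff_le[OF f, where C=C and D=D])
         (use bound D hq in \<open>simp_all flip: of_real_diff\<close>)
    moreover have "norm ((CLINT \<omega>|M'. f' \<omega> * complex_of_real (h (scaled_sin n (Y \<omega>)))) -
          (CLINT \<omega>|M'. f' \<omega> * complex_of_real (q (scaled_sin n (Y \<omega>))))) \<le> e * (LINT \<omega>|M'. norm (f' \<omega>))"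
      by (rule norm_integral_mult_diff_le[OF f', where C=C and D=D])
         (use bound D hq in \<open>simp_all flip: of_real_diff\<close>)
    ultimately show ?thesis
      using norm_triangle_ineq4[THEN order_trans, OF add_mono] q'(1)
      unfolding K_def ring_distribs by fastforce
  qed
  have "norm (?L - ?R) \<le> 0 + e" if "0 < e" for e
  proof -
    \<comment> \<open>Dividing by \<open>K + 1\<close> instead of \<open>K\<close> covers the case
      \<open>K = 0\<close>.\<close>
    have "norm (?L - ?R) \<le> e / (K + 1) * K" by (rule approx) (use K0 that in auto)
    also have "\<dots> \<le> e" using K0 that by (simp add: field_simps)
    finally show ?thesis by simp
  qed
  then have "norm (?L - ?R) \<le> 0" by (rule field_le_epsilon)
  then show ?thesis by simp
qed

lemma integral_continuous:
  fixes h :: "'e \<Rightarrow> real"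
  assumes h: "continuous_on UNIV h" and bound: "\<And>x. \<bar>h x\<bar> \<le> C"
  shows "(CLINT \<omega>|M. f \<omega> * complex_of_real (h (X \<omega>))) = (CLINT \<omega>|M'. f' \<omega> * complex_of_real (h (Y \<omega>)))"
proof -
  have [measurable]: "h \<in> borel_measurable borel" by (rule borel_measurable_continuous_onI[OF h])
  have "(\<lambda>n. CLINT \<omega>|M. f \<omega> * complex_of_real (h (scaled_sin n (X \<omega>)))) \<longlonglongrightarrow> (CLINT \<omega>|M. f \<omega> * complex_of_real (h (X \<omega>)))"
    by (rule tendsto_integral_mult_bounded[OF f, where C=C])
       (auto simp: bound intro!: tendsto_intros continuous_on_tendsto_compose[OF h] scaled_sin_tendsto)
  moreover have "(\<lambda>n. CLINT \<omega>|M'. f' \<omega> * complex_of_real (h (scaled_sin n (Y \<omega>)))) \<longlonglongrightarrow> (CLINT \<omega>|M'. f' \<omega> * complex_of_real (h (Y \<omega>)))"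
    by (rule tendsto_integral_mult_bounded[OF f', where C=C])
       (auto simp: bound intro!: tendsto_intros continuous_on_tendsto_compose[OF h] scaled_sin_tendsto)
  ultimately show ?thesis
    unfolding integral_continuous_scaled_sin[OF assms]
    by (rule LIMSEQ_unique)
qed

lemma integral_indicator_closed:
  assumes A: "closed A"
  shows "(CLINT \<omega>|M. f \<omega> * indicator A (X \<omega>)) = (CLINT \<omega>|M'. f' \<omega> * indicator A (Y \<omega>))"
\<comment> \<open>The empty set is split off because \<open>infdist\<close> to it is 0 by
  convention, so the cut-offs below would be constantly 1 instead of tending to 0.\<close>
proof (cases "A = {}")
  case False
  \<comment> \<open>Continuous cut-offs that equal 1 on \<open>A\<close> and, for n > 0, vanish at
    distance at least 1/n from it. Since \<open>A\<close> is closed, every point outside has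
    positive distance, so they converge pointwise to the indicator.\<close>
  define h where "h n x = max 0 (1 - real n * infdist x A)" for n x
  have h: "continuous_on UNIV (h n)" "\<bar>h n x\<bar> \<le> 1" for n x
    unfolding h_def by (intro continuous_intros) (auto simp: max_def infdist_nonneg)
  have [measurable]: "h n \<in> borel_measurable borel" for n
    by (rule borel_measurable_continuous_onI[OF h(1)])
  have hlim: "(\<lambda>n. complex_of_real (h n x)) \<longlonglongrightarrow> indicator A x" for x
  proof (cases "x \<in> A")
    case True then show ?thesis by (simp add: h_def)
  next
    case nA: False
    then have d: "0 < infdist x A" using A False
      by (metis in_closed_iff_infdist_zero infdist_nonneg less_eq_real_def)
    obtain n0 where n0: "1 / infdist x A < real n0" using reals_Archimedean2 by blast
    have "h n x = 0" if "n \<ge> n0" for n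
    proof -
      have "1 / infdist x A < real n" using n0 that by linarith
      then show ?thesis using d by (simp add: h_def field_simps)
    qed
    then have "\<forall>\<^sub>F n in sequentially. complex_of_real (h n x) = indicator A x"
      using nA by (auto simp: eventually_sequentially)
    then show ?thesis by (rule tendsto_eventually)
  qed
  have "(\<lambda>n. CLINT \<omega>|M. f \<omega> * complex_of_real (h n (X \<omega>))) \<longlonglongrightarrow> (CLINT \<omega>|M. f \<omega> * indicator A (X \<omega>))"
    by (rule tendsto_integral_mult_bounded[OF f, where C=1]) (auto simp: h hlim)
  moreover have "(\<lambda>n. CLINT \<omega>|M'. f' \<omega> * complex_of_real (h n (Y \<omega>))) \<longlonglongrightarrow> (CLINT \<omega>|M'. f' \<omega> * indicator A (Y \<omega>))"
    by (rule tendsto_integral_mult_bounded[OF f', where C=1]) (auto simp: h hlim)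
  ultimately show ?thesis
    unfolding integral_continuous[OF h]
    by (rule LIMSEQ_unique)
qed simp

lemma integral_indicator_borel:
  assumes "A \<in> sets borel"
  shows "(CLINT \<omega>|M. f \<omega> * indicator A (X \<omega>)) = (CLINT \<omega>|M'. f' \<omega> * indicator A (Y \<omega>))"
proof (rule integral_indicator_eq_generator[OF _ _ _ X Y f f' _ _ assms])
  show "sets borel = sigma_sets (space borel) (Collect closed :: 'e set set)"
    by (simp add: borel_eq_closed)
  show "Int_stable (Collect closed :: 'e set set)" by (auto simp: Int_stable_def)
  show "integral\<^sup>L M f = integral\<^sup>L M' f'" using fourier[of 0] by simp
qed (auto intro: integral_indicator_closed)

end

text \<open>Characters are replaced by indicators one coordinate at a time. For fixed frequencies on
  \<open>J\<close> the characters of those coordinates go into the weight, and the one-vector result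
  puts an indicator in coordinate \<open>j\<close>. That indicator then becomes part of the weight
  for the induction hypothesis, which is why the induction generalizes over \<open>f\<close> and
  \<open>f'\<close>.\<close>

lemma fourier_uniqueness_box:
  fixes f :: "'a \<Rightarrow> complex" and f' :: "'b \<Rightarrow> complex"
    and X :: "'i \<Rightarrow> 'a \<Rightarrow> 'e::euclidean_space" and Y :: "'i \<Rightarrow> 'b \<Rightarrow> 'e"
  assumes "finite I" and "integrable M f" "integrable M' f'"
    and "\<And>i. i \<in> I \<Longrightarrow> X i \<in> borel_measurable M" "\<And>i. i \<in> I \<Longrightarrow> Y i \<in> borel_measurable M'"
    and "\<And>u. (CLINT \<omega>|M. f \<omega> * iexp (\<Sum>i\<in>I. u i \<bullet> X i \<omega>)) = (CLINT \<omega>|M'. f' \<omega> * iexp (\<Sum>i\<in>I. u i \<bullet> Y i \<omega>))"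
    and "\<And>i. i \<in> I \<Longrightarrow> A i \<in> sets borel"
  shows "(CLINT \<omega>|M. f \<omega> * (\<Prod>i\<in>I. indicator (A i) (X i \<omega>))) = (CLINT \<omega>|M'. f' \<omega> * (\<Prod>i\<in>I. indicator (A i) (Y i \<omega>)))"
  using assms
proof (induction I arbitrary: f f' rule: finite_induct)
  case empty
  then show ?case by simp
next
  case (insert j J)
  note [measurable] = insert.prems(3,4)[OF insertI1] insert.prems(6)[OF insertI1]
    insert.prems(3,4)[OF insertI2] borel_measurable_integrable[OF insert.prems(1)]
    borel_measurable_integrable[OF insert.prems(2)]
  have [measurable]: "(\<lambda>\<omega>. \<Sum>i\<in>J. u i \<bullet> X i \<omega>) \<in> borel_measurable M" for u
    by (intro borel_measurable_sum borel_measurable_inner borel_measurable_const insert.prems(3)[OF insertI2])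
  have [measurable]: "(\<lambda>\<omega>. \<Sum>i\<in>J. u i \<bullet> Y i \<omega>) \<in> borel_measurable M'" for u
    by (intro borel_measurable_sum borel_measurable_inner borel_measurable_const insert.prems(4)[OF insertI2])
  have step: "(CLINT \<omega>|M. f \<omega> * indicator (A j) (X j \<omega>) * iexp (\<Sum>i\<in>J. u i \<bullet> X i \<omega>)) =
     (CLINT \<omega>|M'. f' \<omega> * indicator (A j) (Y j \<omega>) * iexp (\<Sum>i\<in>J. u i \<bullet> Y i \<omega>))" for u
  proof -
    interpret equal_fourier_integrals M M' "\<lambda>\<omega>. f \<omega> * iexp (\<Sum>i\<in>J. u i \<bullet> X i \<omega>)"
      "\<lambda>\<omega>. f' \<omega> * iexp (\<Sum>i\<in>J. u i \<bullet> Y i \<omega>)" "X j" "Y j"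
    proof unfold_locales
      show "integrable M (\<lambda>\<omega>. f \<omega> * iexp (\<Sum>i\<in>J. u i \<bullet> X i \<omega>))"
        by (rule integrable_mult_bounded[where C=1, OF insert.prems(1)]) simp_all
      show "integrable M' (\<lambda>\<omega>. f' \<omega> * iexp (\<Sum>i\<in>J. u i \<bullet> Y i \<omega>))"
        by (rule integrable_mult_bounded[where C=1, OF insert.prems(2)]) simp_all
      fix t
      define v where "v = u(j := t)"
      have eq: "iexp (\<Sum>i\<in>J. u i \<bullet> z i) * iexp (t \<bullet> z j) = iexp (\<Sum>i\<in>insert j J. v i \<bullet> z i)" for z :: "'i \<Rightarrow> 'e"
      proof -
        have "(\<Sum>i\<in>J. v i \<bullet> z i) = (\<Sum>i\<in>J. u i \<bullet> z i)"
          using insert.hyps by (intro sum.cong) (auto simp: v_def)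
        then show ?thesis using insert.hyps
          by (simp add: v_def exp_add ring_distribs mult.commute)
      qed
      show "(CLINT \<omega>|M. f \<omega> * iexp (\<Sum>i\<in>J. u i \<bullet> X i \<omega>) * iexp (t \<bullet> X j \<omega>)) =
        (CLINT \<omega>|M'. f' \<omega> * iexp (\<Sum>i\<in>J. u i \<bullet> Y i \<omega>) * iexp (t \<bullet> Y j \<omega>))"
        using insert.prems(5)[of v] unfolding mult.assoc eq[of "\<lambda>i. X i _"] eq[of "\<lambda>i. Y i _"] .
    qed measurable
    show ?thesis using integral_indicator_borel[OF insert.prems(6)[OF insertI1]] by (simp only: mult_ac)
  qed
  have "(CLINT \<omega>|M. (f \<omega> * indicator (A j) (X j \<omega>)) * (\<Prod>i\<in>J. indicator (A i) (X i \<omega>))) =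
      (CLINT \<omega>|M'. (f' \<omega> * indicator (A j) (Y j \<omega>)) * (\<Prod>i\<in>J. indicator (A i) (Y i \<omega>)))"
  proof (rule insert.IH[OF _ _ _ _ step])
    show "integrable M (\<lambda>\<omega>. f \<omega> * indicator (A j) (X j \<omega>))"
      by (rule integrable_mult_bounded[where C=1, OF insert.prems(1)]) (measurable, simp add: indicator_def)
    show "integrable M' (\<lambda>\<omega>. f' \<omega> * indicator (A j) (Y j \<omega>))"
      by (rule integrable_mult_bounded[where C=1, OF insert.prems(2)]) (measurable, simp add: indicator_def)
  qed (use insert.prems in auto)
  then show ?case using insert.hyps by (simp add: mult.assoc)
qed

lemma fourier_uniqueness_PiM:
  fixes f :: "'a \<Rightarrow> complex" and f' :: "'b \<Rightarrow> complex"
    and X :: "'a \<Rightarrow> 'i \<Rightarrow> 'e::euclidean_space" and Y :: "'b \<Rightarrow> 'i \<Rightarrow> 'e"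
  assumes I: "finite I" and f: "integrable M f" and f': "integrable M' f'"
    and X: "X \<in> M \<rightarrow>\<^sub>M Pi\<^sub>M I (\<lambda>_. borel)" and Y: "Y \<in> M' \<rightarrow>\<^sub>M Pi\<^sub>M I (\<lambda>_. borel)"
    and eq: "\<And>u. (CLINT \<omega>|M. f \<omega> * iexp (\<Sum>i\<in>I. u i \<bullet> X \<omega> i)) = (CLINT \<omega>|M'. f' \<omega> * iexp (\<Sum>i\<in>I. u i \<bullet> Y \<omega> i))"
    and A: "A \<in> sets (Pi\<^sub>M I (\<lambda>_. borel))"
  shows "(CLINT \<omega>|M. f \<omega> * indicator A (X \<omega>)) = (CLINT \<omega>|M'. f' \<omega> * indicator A (Y \<omega>))"
proof (rule integral_indicator_eq_generator[OF _ _ Int_stable_prod_algebra X Y f f' _ _ A])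
  show "sets (Pi\<^sub>M I (\<lambda>_. borel)) = sigma_sets (space (Pi\<^sub>M I (\<lambda>_. borel))) (prod_algebra I (\<lambda>_. borel))"
    by (simp add: sets_PiM space_PiM)
  show "prod_algebra I (\<lambda>_. borel) \<subseteq> Pow (space (Pi\<^sub>M I (\<lambda>_. borel)))"
    using prod_algebra_sets_into_space[of I "\<lambda>_. borel"] by (simp add: space_PiM)
  show "integral\<^sup>L M f = integral\<^sup>L M' f'" using eq[of "\<lambda>_. 0"] by simp
  fix B :: "('i \<Rightarrow> 'e) set" assume "B \<in> prod_algebra I (\<lambda>_. borel)"
  then obtain E where B: "B = Pi\<^sub>E I E" and E: "\<And>i. i \<in> I \<Longrightarrow> E i \<in> sets borel"
    unfolding prod_algebra_eq_finite[OF I] by (auto simp: Pi_iff)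
  \<comment> \<open>A box in the product space also requires its members to be extensional, so the
    two sides agree only for \<open>z\<close> in that space.\<close>
  have ind: "(\<Prod>i\<in>I. indicator (E i) (z i)) = (indicator B z :: complex)"
    if "z \<in> space (Pi\<^sub>M I (\<lambda>_. borel))" for z
  proof -
    have ext: "z \<in> extensional I" using that by (auto simp: space_PiM PiE_def)
    show ?thesis
    proof (cases "z \<in> B")
      case True then show ?thesis by (auto simp: B PiE_iff)
    next
      case False
      then obtain i where "i \<in> I" "z i \<notin> E i" using ext by (auto simp: B PiE_iff)
      then have "(\<Prod>i\<in>I. indicator (E i) (z i)) = (0::complex)"
        using I by (intro prod_zero) (auto simp: indicator_def)
      then show ?thesis using False by simp
    qed
  qed
  have "(CLINT \<omega>|M. f \<omega> * (\<Prod>i\<in>I. indicator (E i) (X \<omega> i))) =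
      (CLINT \<omega>|M'. f' \<omega> * (\<Prod>i\<in>I. indicator (E i) (Y \<omega> i)))"
    by (rule fourier_uniqueness_box[OF I f f' _ _ eq E])
       (use X Y in \<open>auto intro: measurable_component_singleton[THEN measurable_compose[rotated]]\<close>)
  also have "(CLINT \<omega>|M. f \<omega> * (\<Prod>i\<in>I. indicator (E i) (X \<omega> i))) = (CLINT \<omega>|M. f \<omega> * indicator B (X \<omega>))"
    by (intro Bochner_Integration.integral_cong refl) (simp add: ind[OF measurable_space[OF X]])
  also have "(CLINT \<omega>|M'. f' \<omega> * (\<Prod>i\<in>I. indicator (E i) (Y \<omega> i))) = (CLINT \<omega>|M'. f' \<omega> * indicator B (Y \<omega>))"
    by (intro Bochner_Integration.integral_cong refl) (simp add: ind[OF measurable_space[OF Y]])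
  finally show "(CLINT \<omega>|M. f \<omega> * indicator B (X \<omega>)) = (CLINT \<omega>|M'. f' \<omega> * indicator B (Y \<omega>))" .
qed

section \<open>Matrices and Moore--Penrose inverses\<close>

lemma matrix_mult_diff_left: "A ** (B - C) = A ** B - A ** C" for A :: "real^'n^'m"
  by (simp add: vec_eq_iff matrix_matrix_mult_def right_diff_distrib sum_subtractf)

lemma matrix_mult_diff_right: "(A - B) ** C = A ** C - B ** C" for A :: "real^'n^'m"
  by (simp add: vec_eq_iff matrix_matrix_mult_def left_diff_distrib sum_subtractf)

lemma matrix_mult_add_right: "(A + B) ** C = A ** C + B ** C" for A :: "real^'n^'m"
  by (simp add: vec_eq_iff matrix_matrix_mult_def distrib_right sum.distrib)

lemma matrix_mult_zero [simp]: "A ** 0 = 0" "0 ** B = 0" for A :: "real^'n^'m" and B :: "real^'k^'n"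
  by (simp_all add: vec_eq_iff matrix_matrix_mult_def)

lemma matrix_mult_sum_left: "A ** (\<Sum>i\<in>I. B i) = (\<Sum>i\<in>I. A ** B i)" for A :: "real^'n^'m"
  by (induction I rule: infinite_finite_induct) (simp_all add: matrix_add_ldistrib)

lemma matrix_mult_sum_right: "(\<Sum>i\<in>I. B i) ** A = (\<Sum>i\<in>I. B i ** A)" for A :: "real^'n^'m"
  by (induction I rule: infinite_finite_induct) (simp_all add: matrix_mult_add_right)

lemma transpose_zero [simp]: "transpose 0 = (0 :: real^'n^'m)"
  by (simp add: vec_eq_iff transpose_def)

lemma transpose_add: "transpose (A + B) = transpose A + transpose B" for A :: "real^'n^'m"
  by (simp add: vec_eq_iff transpose_def)

lemma transpose_diff: "transpose (A - B) = transpose A - transpose B" for A :: "real^'n^'m"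
  by (simp add: vec_eq_iff transpose_def)

lemma transpose_sum: "transpose (\<Sum>i\<in>I. A i) = (\<Sum>i\<in>I. transpose (A i))" for A :: "'i \<Rightarrow> real^'n^'m"
  by (induction I rule: infinite_finite_induct) (simp_all add: transpose_add)

lemma matrix_sum_vector: "(\<Sum>i\<in>I. A i) *v x = (\<Sum>i\<in>I. A i *v x)" for A :: "'i \<Rightarrow> real^'n^'m"
  by (induction I rule: infinite_finite_induct) (simp_all add: matrix_vector_mult_add_rdistrib)

lemma inner_matrix_vector: "x \<bullet> (A *v y) = (transpose A *v x) \<bullet> y" for A :: "real^'n^'m"
  by (simp add: dot_lmul_matrix)

lemma inner_gram: "v \<bullet> ((C ** transpose C) *v v) = (transpose C *v v) \<bullet> (transpose C *v v)" for C :: "real^'n^'m"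
  by (simp only: matrix_vector_mul_assoc[symmetric] inner_matrix_vector transpose_transpose)

lemmas matrix_algebra = matrix_mul_assoc matrix_mult_diff_left matrix_mult_diff_right
  matrix_add_ldistrib matrix_mult_add_right matrix_transpose_mul transpose_add transpose_diff

text \<open>\<open>M ** X\<close> and \<open>M ** Y\<close> are both the orthogonal projection onto
  the range of \<open>M\<close>, and \<open>X ** M\<close> and \<open>Y ** M\<close> are both the
  orthogonal projection with the kernel of \<open>M\<close>. With these equalities X = X M X = X M Y
  = Y M Y = Y.\<close>

lemma is_pseudo_inverse_unique:
  assumes X: "is_pseudo_inverse M X" and Y: "is_pseudo_inverse M Y"
  shows "X = Y"
proof -
  have x: "M ** X ** M = M" "X ** M ** X = X" "transpose (M ** X) = M ** X" "transpose (X ** M) = X ** M"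
    and y: "M ** Y ** M = M" "Y ** M ** Y = Y" "transpose (M ** Y) = M ** Y" "transpose (Y ** M) = Y ** M"
    using X Y by (auto simp: is_pseudo_inverse_def)
  have "transpose ((M ** X) ** (M ** Y)) = transpose (M ** Y)"
    by (simp add: matrix_mul_assoc x)
  then have MXY: "M ** X = M ** Y"
    using x(3) y(1) y(3) by (metis matrix_mul_assoc matrix_transpose_mul)
  have "transpose ((X ** M) ** (Y ** M)) = transpose (X ** M)"
    by (metis matrix_mul_assoc y(1))
  then have "(Y ** M) ** (X ** M) = X ** M"
    using x(4) y(4) by (simp only: matrix_transpose_mul[of "X ** M" "Y ** M"])
  then have XMY: "Y ** M = X ** M" by (metis matrix_mul_assoc x(1))
  have "X = X ** (M ** X)" by (simp add: matrix_mul_assoc x)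
  also have "\<dots> = (X ** M) ** Y" by (simp add: MXY matrix_mul_assoc)
  also have "\<dots> = Y" by (simp add: XMY[symmetric] y)
  finally show ?thesis .
qed

text \<open>A symmetric matrix is injective on its own range: if \<open>x = G *v y\<close> lies in
  the kernel, then \<open>x \<bullet> x = (G *v x) \<bullet> y = 0\<close>. By dimension it maps its
  range onto itself, so every column of \<open>G\<close> is \<open>G *v (G *v y)\<close> for some
  \<open>y\<close>; these vectors are the columns of the witness.\<close>

lemma symmetric_range_square:
  fixes G :: "real^'n^'n"
  assumes sym: "transpose G = G"
  shows "\<exists>Y. G = G ** G ** Y"
proof -
  let ?R = "range ((*v) G)"
  have sub: "subspace ?R" by (intro linear_subspace_image subspace_UNIV) auto
  have inj: "inj_on ((*v) G) (span ?R)"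
  proof (rule linear_injective_on_subspace_0[THEN iffD2])
    show "\<forall>x\<in>span ?R. G *v x = 0 \<longrightarrow> x = 0"
    proof (intro ballI impI)
      fix x assume x: "x \<in> span ?R" and 0: "G *v x = 0"
      then obtain y where y: "x = G *v y" using span_eq_iff[THEN iffD2, OF sub] by auto
      have "x \<bullet> x = (G *v x) \<bullet> y"
        unfolding y inner_matrix_vector sym ..
      then show "x = 0" using 0 by simp
    qed
  qed auto
  have "dim ((*v) G ` ?R) = dim ?R" by (rule dim_image_eq[OF _ inj]) auto
  then have eq: "(*v) G ` ?R = ?R"
    by (intro subspace_dim_equal linear_subspace_image sub) auto
  have "\<exists>y. G *v axis i 1 = G *v (G *v y)" for i
  proof -
    have "G *v axis i 1 \<in> (*v) G ` ?R" unfolding eq by simp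
    then show ?thesis by auto
  qed
  then obtain y where y: "\<And>i. G *v axis i 1 = G *v (G *v y i)" by metis
  let ?Y = "\<chi> i j. y j $ i"
  have "?Y *v axis j 1 = y j" for j
    by (simp add: matrix_vector_mult_basis column_def vec_eq_iff)
  then have "G *v axis j 1 = (G ** G ** ?Y) *v axis j 1" for j
    using y[of j] by (simp only: matrix_vector_mul_assoc[symmetric])
  then have "G = G ** G ** ?Y"
    by (simp add: matrix_vector_mult_basis column_def vec_eq_iff)
  then show ?thesis ..
qed

text \<open>With \<open>G\<^sup>2 Y = G\<close> the symmetric matrix \<open>G Y\<close> is the orthogonal projection onto the range of \<open>G\<close>.\<close>

lemma is_pseudo_inverse_pseudo_inverse:
  fixes G :: "real^'n^'n"
  assumes sym: "transpose G = G"
  shows "is_pseudo_inverse G (pseudo_inverse G)"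
proof -
  obtain Y where Y: "G = G ** G ** Y" using symmetric_range_square[OF sym] by blast
  have Y': "G = transpose Y ** G ** G"
    using arg_cong[OF Y, of transpose] by (simp only: matrix_transpose_mul sym matrix_mul_assoc)
  define E where "E = G ** Y"
  have E: "transpose Y ** G = E"
    unfolding E_def by (metis Y Y' matrix_mul_assoc)
  have Esym: "transpose E = E"
    using E by (simp add: E_def matrix_transpose_mul sym)
  have EG: "E ** G = G" "G ** E = G"
    unfolding E_def by (metis E E_def Y') (metis Y matrix_mul_assoc)
  \<comment> \<open>Since \<open>transpose Y ** G = E\<close>, this is \<open>E ** Y\<close>: the
    solution \<open>Y\<close> projected to the range of \<open>G\<close>. The symmetric form makes
    the computations of \<open>G ** X\<close> and \<open>X ** G\<close> mirror each other.\<close>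
  define X where "X = transpose Y ** G ** Y"
  have GX: "G ** X = E"
    unfolding X_def E by (metis E E_def EG(2) matrix_mul_assoc)
  have XG: "X ** G = E"
    unfolding X_def by (metis E E_def EG(1) matrix_mul_assoc)
  have "X ** G ** X = E ** E ** Y"
    by (simp add: XG) (simp add: X_def E matrix_mul_assoc)
  also have "\<dots> = X"
    unfolding X_def E by (metis E_def EG(1) matrix_mul_assoc)
  finally have "is_pseudo_inverse G X"
    unfolding is_pseudo_inverse_def using GX XG EG Esym by simp
  then show ?thesis
    unfolding pseudo_inverse_def using is_pseudo_inverse_unique by (blast intro: theI)
qed

lemma pseudo_inverse_symmetric:
  fixes G :: "real^'n^'n"
  assumes sym: "transpose G = G"
  shows "transpose (pseudo_inverse G) = pseudo_inverse G"
proof (rule is_pseudo_inverse_unique)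
  show "is_pseudo_inverse G (pseudo_inverse G)" by (rule is_pseudo_inverse_pseudo_inverse[OF sym])
  then show "is_pseudo_inverse G (transpose (pseudo_inverse G))"
    unfolding is_pseudo_inverse_def by (metis sym matrix_transpose_mul matrix_mul_assoc)
qed

lemma pseudo_inverse_invertible:
  fixes G :: "real^'n^'n"
  assumes sym: "transpose G = G" and inv: "invertible G"
  shows "pseudo_inverse G ** G = mat 1" "G ** pseudo_inverse G = mat 1"
proof -
  let ?X = "pseudo_inverse G"
  have eq: "G ** ?X ** G = G" using is_pseudo_inverse_pseudo_inverse[OF sym] by (simp add: is_pseudo_inverse_def)
  obtain H where H: "G ** H = mat 1" "H ** G = mat 1" using inv unfolding invertible_def by blast
  show "?X ** G = mat 1" by (metis eq H(2) matrix_mul_assoc matrix_mul_lid)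
  show "G ** ?X = mat 1" by (metis eq H(1) matrix_mul_assoc matrix_mul_rid)
qed

text \<open>The kernel of a sum of positive semidefinite matrices lies in the kernel of each
  summand, and \<open>pseudo_inverse G ** G\<close> differs from the identity only by a map into the
  kernel of \<open>G\<close>. This absorption takes the place of cancellation when \<open>G\<close>
  is singular.\<close>

lemma gram_sum_absorb:
  fixes C :: "real^'m^'n" and G H :: "real^'n^'n"
  assumes sym: "transpose G = G" and G: "G = C ** transpose C + H" and H: "\<And>v. 0 \<le> v \<bullet> (H *v v)"
  shows "transpose C ** pseudo_inverse G ** G = transpose C"
    and "G ** pseudo_inverse G ** C = C"
proof -
  have pi: "G ** pseudo_inverse G ** G = G"
    using is_pseudo_inverse_pseudo_inverse[OF sym] by (simp add: is_pseudo_inverse_def)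
  have "(transpose C ** pseudo_inverse G ** G) *v v = transpose C *v v" for v
  proof -
    define d where "d = (pseudo_inverse G ** G) *v v - v"
    have "G *v d = 0"
      by (simp add: d_def matrix_vector_mult_diff_distrib matrix_vector_mul_assoc matrix_mul_assoc pi)
    then have "0 = d \<bullet> ((C ** transpose C) *v d) + d \<bullet> (H *v d)"
      using G by (metis inner_zero_right inner_add_right matrix_vector_mult_add_rdistrib)
    then have "(transpose C *v d) \<bullet> (transpose C *v d) \<le> 0"
      using H[of d] unfolding inner_gram by linarith
    then have "transpose C *v d = 0" by (metis inner_eq_zero_iff inner_ge_zero order_antisym)
    then show ?thesis
      by (simp only: d_def matrix_vector_mult_diff_distrib matrix_vector_mul_assoc matrix_mul_assoc) simp
  qed
  then show *: "transpose C ** pseudo_inverse G ** G = transpose C" by (simp add: matrix_eq)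
  from arg_cong[OF this, of transpose] show "G ** pseudo_inverse G ** C = C"
    by (simp only: matrix_transpose_mul transpose_transpose sym pseudo_inverse_symmetric[OF sym] matrix_mul_assoc)
qed

text \<open>With \<open>z\<close> and \<open>q\<close> as in the proof, q = z \<bullet> G z.
  Positivity of \<open>H\<close> bounds the squared norm of \<open>transpose C *v z\<close> by
  \<open>q\<close>, and expanding the squared norm of \<open>v - transpose C *v z\<close> then gives
  q \<le> v \<bullet> v, which is the claim.\<close>

lemma covariance_matrix_gram_complement:
  fixes C :: "real^'m^'n" and G H :: "real^'n^'n"
  assumes sym: "transpose G = G" and G: "G = C ** transpose C + H" and H: "\<And>v. 0 \<le> v \<bullet> (H *v v)"
  shows "covariance_matrix (mat 1 - transpose C ** pseudo_inverse G ** C)"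
  unfolding covariance_matrix_def
proof (intro conjI allI)
  let ?X = "pseudo_inverse G"
  have X: "transpose ?X = ?X" by (rule pseudo_inverse_symmetric[OF sym])
  have pi: "?X ** G ** ?X = ?X"
    using is_pseudo_inverse_pseudo_inverse[OF sym] by (simp add: is_pseudo_inverse_def)
  show "transpose (mat 1 - transpose C ** ?X ** C) = mat 1 - transpose C ** ?X ** C"
    by (simp add: matrix_algebra X)
  fix v
  define z where "z = (?X ** C) *v v"
  define q where "q = v \<bullet> (transpose C *v z)"
  have q: "q = v \<bullet> ((transpose C ** ?X ** C) *v v)"
    unfolding q_def z_def by (simp only: matrix_vector_mul_assoc matrix_mul_assoc)
  also have "\<dots> = v \<bullet> ((transpose C ** (?X ** G ** ?X) ** C) *v v)" unfolding pi ..
  also have "\<dots> = z \<bullet> (G *v z)"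
    unfolding z_def
    by (simp only: inner_matrix_vector matrix_transpose_mul transpose_transpose X sym
        matrix_vector_mul_assoc matrix_mul_assoc)
  also have "\<dots> = (transpose C *v z) \<bullet> (transpose C *v z) + z \<bullet> (H *v z)"
    by (subst G) (simp only: matrix_vector_mult_add_rdistrib inner_add_right inner_gram)
  finally have le: "(transpose C *v z) \<bullet> (transpose C *v z) \<le> q" using H[of z] by simp
  have "0 \<le> (v - transpose C *v z) \<bullet> (v - transpose C *v z)" by simp
  also have "\<dots> = v \<bullet> v - 2 * q + (transpose C *v z) \<bullet> (transpose C *v z)"
    unfolding q_def by (simp add: inner_diff_left inner_diff_right inner_commute)
  finally have "q \<le> v \<bullet> v" using le by linarith
  then show "0 \<le> v \<bullet> ((mat 1 - transpose C ** ?X ** C) *v v)"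
    unfolding q by (simp add: matrix_vector_mult_diff_rdistrib inner_diff_right del: transpose_matrix_vector)
qed

section \<open>Covariances of the bridge\<close>

text \<open>The coefficient of noise \<open>j\<close> in the state at time \<open>k\<close> of an
  affine recursion whose deterministic part is \<open>drift\<close>. The recursive form needs no
  inverse of \<open>F\<close>; the closed-loop matrices can be singular.\<close>

primrec noise_gain :: "(nat \<Rightarrow> real^'n^'n) \<Rightarrow> (nat \<Rightarrow> real^'m^'n) \<Rightarrow> nat \<Rightarrow> nat \<Rightarrow> real^'m^'n" where
  "noise_gain F B 0 j = 0"
| "noise_gain F B (Suc k) j = F k ** noise_gain F B k j + (if j = k then B k else 0)"

primrec drift :: "(nat \<Rightarrow> real^'n^'n) \<Rightarrow> (nat \<Rightarrow> real^'n) \<Rightarrow> real^'n \<Rightarrow> nat \<Rightarrow> real^'n" where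
  "drift F b x0 0 = x0"
| "drift F b x0 (Suc k) = F k *v drift F b x0 k + b k"

lemma noise_gain_causal: "k \<le> j \<Longrightarrow> noise_gain F B k j = 0"
  by (induction k) auto

text \<open>The hypothesis says that the time-dependent coordinates \<open>T k\<close> intertwine
  two recursions. It is applied with the transition matrices to the final time, both to the free
  system, where \<open>F'\<close> becomes the identity, and to the closed loop.\<close>

lemma noise_gain_transform:
  assumes "\<And>k. k < N \<Longrightarrow> T (Suc k) ** F k = F' k ** T k" and "k \<le> N"
  shows "T k ** noise_gain F B k j = noise_gain F' (\<lambda>k. T (Suc k) ** B k) k j"
  using assms(2)
proof (induction k)
  case (Suc k)
  have "T (Suc k) ** (F k ** noise_gain F B k j) = F' k ** (T k ** noise_gain F B k j)"
    using assms(1)[of k] Suc.prems by (simp add: matrix_mul_assoc)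
  with Suc show ?case by (simp add: matrix_add_ldistrib)
qed simp

lemma drift_transform:
  assumes "\<And>k. k < N \<Longrightarrow> T (Suc k) ** F k = F' k ** T k" and "k \<le> N"
  shows "T k *v drift F b x0 k = drift F' (\<lambda>k. T (Suc k) *v b k) (T 0 *v x0) k"
  using assms(2)
proof (induction k)
  case (Suc k)
  have "T (Suc k) *v (F k *v drift F b x0 k) = F' k *v (T k *v drift F b x0 k)"
    using assms(1)[of k] Suc.prems by (simp add: matrix_vector_mul_assoc)
  with Suc show ?case by (simp add: matrix_vector_right_distrib)
qed simp

lemma noise_gain_identity: "noise_gain (\<lambda>_. mat 1) C k j = (if j < k then C j else 0)"
  by (induction k) auto

lemma drift_identity: "drift (\<lambda>_. mat 1) (\<lambda>_. 0) x0 k = x0"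
  by (induction k) auto

lemma product_up_Suc_shift: "product_up A l (Suc d) = product_up A (Suc l) d ** A l"
  by (induction d) (simp_all add: matrix_mul_assoc)

lemma invertible_cancel_left:
  fixes T :: "real^'n^'n"
  assumes "invertible T" and "T ** X = T ** Y"
  shows "X = Y"
  using assms unfolding invertible_def by (metis matrix_mul_assoc matrix_mul_lid)

lemma invertible_cancel_right:
  fixes T :: "real^'n^'n"
  assumes "invertible T" and "X ** transpose T = Y ** transpose T"
  shows "X = Y"
  using invertible_cancel_left[OF assms(1), of "transpose X" "transpose Y"] arg_cong[OF assms(2), of transpose]
  by (simp add: matrix_transpose_mul)

locale reachable_system =
  fixes A :: "nat \<Rightarrow> real^'n^'n" and B :: "nat \<Rightarrow> real^'m^'n" and N :: nat
  assumes A_invertible: "\<And>k. k < N \<Longrightarrow> invertible (A k)"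
    and reachable: "invertible (reach_gramian A B N 0)"
begin

abbreviation "\<Phi> k \<equiv> state_transition A N k"
abbreviation "G k \<equiv> reach_gramian A B N k"
abbreviation "Gi k \<equiv> pseudo_inverse (G k)"

definition "C k = \<Phi> (Suc k) ** B k"
text \<open>What \<open>A_hat\<close> becomes in the coordinates of the random walk.\<close>

definition "F k = mat 1 - C k ** transpose (C k) ** Gi k"

lemma transition_step: "k < N \<Longrightarrow> \<Phi> (Suc k) ** A k = \<Phi> k"
  unfolding state_transition_def
  using product_up_Suc_shift[of A k "N - Suc k"] by (simp add: Suc_diff_Suc)

lemma transition_final: "\<Phi> N = mat 1"
  by (simp add: state_transition_def)

lemma transition_invertible: "k \<le> N \<Longrightarrow> invertible (\<Phi> k)"
proof (induction k rule: inc_induct)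
  case base
  show ?case unfolding transition_final invertible_def by (intro exI[of _ "mat 1"]) simp
next
  case (step k)
  then show ?case using invertible_mult[OF _ A_invertible] by (metis transition_step)
qed

lemma gramian_sum: "G k = (\<Sum>j\<in>{k..<N}. C j ** transpose (C j))"
  unfolding reach_gramian_def C_def by (simp add: matrix_transpose_mul matrix_mul_assoc)

lemma gramian_step: "k < N \<Longrightarrow> G k = C k ** transpose (C k) + G (Suc k)"
  unfolding gramian_sum by (rule sum.atLeast_Suc_lessThan)

lemma gramian_final: "G N = 0"
  by (simp add: gramian_sum)

lemma gramian_symmetric: "transpose (G k) = G k"
  unfolding gramian_sum by (simp add: transpose_sum matrix_transpose_mul)

lemma gramian_nonneg: "0 \<le> v \<bullet> (G k *v v)"
  unfolding gramian_sum matrix_sum_vector inner_sum_right inner_gram by (intro sum_nonneg) simp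

lemma gramian_symmetric_inverse: "transpose (Gi k) = Gi k"
  by (rule pseudo_inverse_symmetric[OF gramian_symmetric])

lemma gramian_absorb:
  assumes "k < N"
  shows "transpose (C k) ** Gi k ** G k = transpose (C k)" and "G k ** Gi k ** C k = C k"
  using gram_sum_absorb[OF gramian_symmetric gramian_step[OF assms] gramian_nonneg] by auto

lemma gramian_inverse: "Gi 0 ** G 0 = mat 1" "G 0 ** Gi 0 = mat 1"
  using pseudo_inverse_invertible[OF gramian_symmetric reachable] by auto

lemma pinned_noise_cov_eq: "pinned_noise_cov A B N k = mat 1 - transpose (C k) ** Gi k ** C k"
  unfolding pinned_noise_cov_def pinned_gain_def C_def by (simp add: matrix_transpose_mul matrix_mul_assoc)

lemma covariance_matrix_pinned_noise_cov: "k < N \<Longrightarrow> covariance_matrix (pinned_noise_cov A B N k)"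
  unfolding pinned_noise_cov_eq
  by (rule covariance_matrix_gram_complement[OF gramian_symmetric gramian_step gramian_nonneg])

lemma A_hat_transform:
  assumes "k < N"
  shows "\<Phi> (Suc k) ** A_hat A B N k = F k ** \<Phi> k"
proof -
  have "\<Phi> (Suc k) ** A_hat A B N k = F k ** (\<Phi> (Suc k) ** A k)"
    unfolding A_hat_def pinned_gain_def F_def C_def by (simp add: matrix_algebra)
  then show ?thesis by (simp add: transition_step assms)
qed

lemma transition_pinned_input: "\<Phi> (Suc k) ** (B k ** pinned_gain A B N k) = C k ** transpose (C k) ** Gi k"
  unfolding pinned_gain_def C_def by (simp add: matrix_algebra)

text \<open>The closed loop transports the Gramian of the remaining time, down to
  \<open>G N = 0\<close>; this is what steers the bridge into its endpoint. Absorption does the work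
  that an inverse of \<open>G k\<close> would do.\<close>

lemma F_gramian:
  assumes "k < N"
  shows "F k ** G k = G (Suc k)"
proof -
  have "F k ** G k = G k - C k ** (transpose (C k) ** Gi k ** G k)"
    by (simp add: F_def matrix_algebra)
  also have "\<dots> = G k - C k ** transpose (C k)" by (simp only: gramian_absorb[OF assms])
  also have "\<dots> = G (Suc k)" by (simp add: gramian_step[OF assms])
  finally show ?thesis .
qed

section \<open>Covariance and mean of the closed loop in random-walk coordinates\<close>

definition "bridge_gain = noise_gain F C"
definition "bridge_cov k l =
  (\<Sum>j<N. bridge_gain k j ** pinned_noise_cov A B N j ** transpose (bridge_gain l j))"

lemma bridge_gain_step: "bridge_gain (Suc k) j = F k ** bridge_gain k j + (if j = k then C k else 0)"
  by (simp add: bridge_gain_def)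

lemma bridge_cov_step:
  assumes "k < N"
  shows "bridge_cov (Suc k) l = F k ** bridge_cov k l + C k ** pinned_noise_cov A B N k ** transpose (bridge_gain l k)"
proof -
  have "bridge_cov (Suc k) l = F k ** bridge_cov k l +
      (\<Sum>j<N. (if j = k then C k else 0) ** pinned_noise_cov A B N j ** transpose (bridge_gain l j))"
    unfolding bridge_cov_def bridge_gain_step
    by (simp add: matrix_mult_add_right sum.distrib matrix_mult_sum_left matrix_mul_assoc)
  also have "(\<Sum>j<N. (if j = k then C k else 0) ** pinned_noise_cov A B N j ** transpose (bridge_gain l j)) =
      (\<Sum>j<N. if j = k then C k ** pinned_noise_cov A B N j ** transpose (bridge_gain l j) else 0)"
    by (intro sum.cong) auto
  finally show ?thesis using assms by simp
qed

lemma bridge_cov_transpose: "k \<le> N \<Longrightarrow> transpose (bridge_cov k l) = bridge_cov l k"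
  unfolding bridge_cov_def transpose_sum
  using covariance_matrix_pinned_noise_cov
  by (intro sum.cong) (auto simp: matrix_transpose_mul matrix_mul_assoc covariance_matrix_def)

text \<open>For \<open>l \<le> k\<close> the noise of step \<open>k\<close> has not entered the
  state at time \<open>l\<close>, so one step multiplies the covariance by \<open>F k\<close> and
  \<open>F_gramian\<close> applies. The new diagonal entry is the only place where the covariance of
  the pinned noise itself matters.\<close>

lemma bridge_cov_eq:
  assumes "k \<le> N" and "l \<le> k"
  shows "bridge_cov k l = G k ** Gi 0 ** (G 0 - G l)"
  using assms
proof (induction k arbitrary: l)
  case 0
  then show ?case by (simp add: bridge_cov_def bridge_gain_def)
next
  case (Suc k)
  then have k: "k < N" by simp
  let ?S = "pinned_noise_cov A B N"
  have past: "bridge_cov (Suc k) l = G (Suc k) ** Gi 0 ** (G 0 - G l)" if "l \<le> k" for l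
  proof -
    have "bridge_gain l k = 0" unfolding bridge_gain_def by (rule noise_gain_causal[OF that])
    then have "bridge_cov (Suc k) l = F k ** bridge_cov k l" by (simp add: bridge_cov_step k)
    also have "\<dots> = F k ** G k ** Gi 0 ** (G 0 - G l)" using Suc.IH[of l] k that by (simp add: matrix_mul_assoc)
    finally show ?thesis by (simp add: F_gramian k)
  qed
  show ?case
  proof (cases "l \<le> k")
    case True
    then show ?thesis by (rule past)
  next
    case False
    with Suc.prems have l: "l = Suc k" by simp
    have gain: "bridge_gain (Suc k) k = C k"
      by (simp add: bridge_gain_step) (simp add: bridge_gain_def noise_gain_causal)
    \<comment> \<open>Two readings of the transposed closed loop: directly after \<open>G k\<close>
      it collapses by \<open>FT\<close>, elsewhere it is expanded by \<open>FT'\<close>.\<close>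
    have FT: "G k ** transpose (F k) = G (Suc k)"
      using arg_cong[OF F_gramian[OF k], of transpose] by (simp add: matrix_transpose_mul gramian_symmetric)
    have FT': "transpose (F k) = mat 1 - Gi k ** (C k ** transpose (C k))"
      by (simp add: F_def matrix_algebra gramian_symmetric_inverse)
    have "bridge_cov k (Suc k) = transpose (F k ** bridge_cov k k)"
      using arg_cong[OF bridge_cov_step[OF k, of k], of transpose] bridge_cov_transpose[of "Suc k" k] k
      by (simp add: bridge_gain_def noise_gain_causal)
    also have "\<dots> = bridge_cov k k ** transpose (F k)"
      using k by (simp add: matrix_transpose_mul bridge_cov_transpose)
    finally have "bridge_cov (Suc k) (Suc k) =
        F k ** bridge_cov k k ** transpose (F k) + C k ** ?S k ** transpose (C k)"
      by (simp add: bridge_cov_step k gain matrix_mul_assoc)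
    also have "F k ** bridge_cov k k = G (Suc k) ** Gi 0 ** (G 0 - G k)"
      using Suc.IH[of k] k by (simp add: matrix_mul_assoc F_gramian)
    also have "G (Suc k) ** Gi 0 ** (G 0 - G k) ** transpose (F k) =
        G (Suc k) ** (Gi 0 ** G 0) ** transpose (F k) - G (Suc k) ** Gi 0 ** (G k ** transpose (F k))"
      by (simp add: matrix_algebra)
    also have "\<dots> = G (Suc k) - G (Suc k) ** Gi k ** (C k ** transpose (C k)) - G (Suc k) ** Gi 0 ** G (Suc k)"
      by (simp add: gramian_inverse FT) (simp add: FT' matrix_algebra)
    also have "C k ** ?S k ** transpose (C k) =
        C k ** transpose (C k) - C k ** transpose (C k) ** Gi k ** (C k ** transpose (C k))"
      by (simp add: pinned_noise_cov_eq matrix_algebra)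
    \<comment> \<open>The two terms with \<open>Gi k\<close> combine, as
      \<open>G (Suc k) + C k ** transpose (C k) = G k\<close>, into
      \<open>G k ** Gi k ** C k ** transpose (C k)\<close>, from which absorption removes the
      pseudo-inverse.\<close>
    also have "G (Suc k) - G (Suc k) ** Gi k ** (C k ** transpose (C k)) - G (Suc k) ** Gi 0 ** G (Suc k) + \<dots> =
        G k - G k ** Gi k ** C k ** transpose (C k) - G (Suc k) ** Gi 0 ** G (Suc k)"
      by (simp add: gramian_step[OF k] matrix_algebra)
    also have "\<dots> = G k - C k ** transpose (C k) - G (Suc k) ** Gi 0 ** G (Suc k)"
      by (simp only: gramian_absorb[OF k])
    also have "\<dots> = G (Suc k) ** (Gi 0 ** G 0) - G (Suc k) ** Gi 0 ** G (Suc k)"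
      by (simp add: gramian_inverse gramian_step[OF k])
    finally show ?thesis by (simp add: l matrix_mult_diff_left matrix_mul_assoc)
  qed
qed

text \<open>The input is chosen so that \<open>y\<close> is a fixed point of every step. The error
  relative to \<open>y\<close> therefore obeys the homogeneous recursion, and
  \<open>F_gramian\<close> carries it along.\<close>

lemma bridge_drift:
  assumes "k \<le> N"
  shows "drift F (\<lambda>k. (C k ** transpose (C k) ** Gi k) *v y) z k = y - (G k ** Gi 0) *v (y - z)"
  using assms
proof (induction k)
  case 0
  then show ?case by (simp add: gramian_inverse)
next
  case (Suc k)
  then have k: "k < N" by simp
  have "drift F (\<lambda>k. (C k ** transpose (C k) ** Gi k) *v y) z (Suc k) =
      F k *v y - F k *v ((G k ** Gi 0) *v (y - z)) + (C k ** transpose (C k) ** Gi k) *v y"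
    using Suc by (simp add: matrix_vector_mult_diff_distrib)
  also have "F k *v ((G k ** Gi 0) *v (y - z)) = (G (Suc k) ** Gi 0) *v (y - z)"
    by (simp only: matrix_vector_mul_assoc matrix_mul_assoc F_gramian[OF k])
  also have "F k *v y = y - (C k ** transpose (C k) ** Gi k) *v y"
    by (simp add: F_def matrix_vector_mult_diff_rdistrib)
  finally show ?case by simp
qed

section \<open>Free covariances and the regression on the final state\<close>

definition "free_cov k l = (\<Sum>j<N. noise_gain A B k j ** transpose (noise_gain A B l j))"

lemma transition_free_gain: "k \<le> N \<Longrightarrow> \<Phi> k ** noise_gain A B k j = (if j < k then C j else 0)"
  using noise_gain_transform[of N \<Phi> A "\<lambda>_. mat 1" k B j]
  by (simp add: transition_step noise_gain_identity flip: C_def)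

lemma free_cov_transpose: "transpose (free_cov k l) = free_cov l k"
  unfolding free_cov_def transpose_sum by (simp add: matrix_transpose_mul)

text \<open>In random-walk coordinates two states share exactly the increments before the earlier
  time \<open>l\<close>.\<close>

lemma transition_free_cov:
  assumes "l \<le> k" "k \<le> N"
  shows "\<Phi> k ** free_cov k l ** transpose (\<Phi> l) = G 0 - G l"
proof -
  have "\<Phi> k ** free_cov k l ** transpose (\<Phi> l) =
     (\<Sum>j<N. (\<Phi> k ** noise_gain A B k j) ** transpose (\<Phi> l ** noise_gain A B l j))"
    unfolding free_cov_def matrix_mult_sum_left matrix_mult_sum_right
    by (simp add: matrix_transpose_mul matrix_mul_assoc)
  also have "\<dots> = (\<Sum>j<N. if j < l then C j ** transpose (C j) else 0)"
    using assms by (intro sum.cong) (auto simp: transition_free_gain)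
  also have "\<dots> = (\<Sum>j\<in>{0..<l}. C j ** transpose (C j))"
    using assms by (simp add: sum.If_cases atLeast0LessThan Int_absorb1 flip: lessThan_def)
  also have "\<dots> = G 0 - G l"
    unfolding gramian_sum using sum.atLeastLessThan_concat[of 0 l N "\<lambda>j. C j ** transpose (C j)"] assms
    by (simp add: algebra_simps)
  finally show ?thesis .
qed

text \<open>This is the only covariance that the conditional law inverts, so reachability turns the
  pseudo-inverse in \<open>regression\<close> into a true inverse.\<close>

lemma free_cov_final: "free_cov N N = G 0"
  using transition_free_cov[of N N] by (simp add: transition_final gramian_final)

definition "regression k = free_cov k N ** Gi 0"

lemma transition_regression:
  assumes "k \<le> N"
  shows "\<Phi> k ** regression k = (G 0 - G k) ** Gi 0"
proof -
  have "\<Phi> k ** free_cov k N = transpose (\<Phi> N ** free_cov N k ** transpose (\<Phi> k))"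
    by (simp add: transition_final matrix_transpose_mul free_cov_transpose)
  also have "\<dots> = G 0 - G k"
    using transition_free_cov[of k N] assms by (simp add: transpose_diff gramian_symmetric)
  finally show ?thesis by (simp add: regression_def matrix_mul_assoc)
qed

text \<open>Both sides are compared after multiplication by the invertible transition matrices,
  where they have the same closed form. That form is available for \<open>l \<le> k\<close> only;
  the other half follows because both families are symmetric under transposition and exchange of the
  indices.\<close>

lemma pinned_cov_eq_conditional_cov:
  assumes "k \<le> N" "l \<le> N"
  shows "(\<Sum>j<N. noise_gain (A_hat A B N) B k j ** pinned_noise_cov A B N j
            ** transpose (noise_gain (A_hat A B N) B l j)) =
         free_cov k l - regression k ** free_cov N l" (is "?P k l = ?Q k l")
proof -
  have gain: "\<Phi> k ** noise_gain (A_hat A B N) B k j = bridge_gain k j" if "k \<le> N" for k j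
    using noise_gain_transform[of N \<Phi> "A_hat A B N" F k B j] that
    by (simp add: A_hat_transform bridge_gain_def flip: C_def)
  have P: "\<Phi> k ** ?P k l ** transpose (\<Phi> l) = bridge_cov k l" if "k \<le> N" "l \<le> N" for k l
    unfolding bridge_cov_def gain[OF that(1), symmetric] gain[OF that(2), symmetric]
      matrix_mult_sum_left matrix_mult_sum_right
    by (simp add: matrix_transpose_mul matrix_mul_assoc)
  have Q: "\<Phi> k ** ?Q k l ** transpose (\<Phi> l) = G k ** Gi 0 ** (G 0 - G l)" if "k \<le> N" "l \<le> k" for k l
  proof -
    have "\<Phi> k ** ?Q k l ** transpose (\<Phi> l) = \<Phi> k ** free_cov k l ** transpose (\<Phi> l)
        - (\<Phi> k ** regression k) ** (\<Phi> N ** free_cov N l ** transpose (\<Phi> l))"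
      by (simp add: matrix_algebra transition_final)
    \<comment> \<open>The identity is inserted as \<open>G 0 ** Gi 0\<close> so that both terms end
      in \<open>Gi 0 ** (G 0 - G l)\<close>.\<close>
    also have "\<dots> = (G 0 ** Gi 0) ** (G 0 - G l) - (G 0 - G k) ** Gi 0 ** (G 0 - G l)"
      using that by (simp add: transition_free_cov transition_regression gramian_inverse)
    finally show ?thesis by (simp add: matrix_mult_diff_right)
  qed
  have lower: "?P k l = ?Q k l" if "k \<le> N" "l \<le> k" for k l
  proof -
    have l: "l \<le> N" using that by simp
    have "\<Phi> k ** ?P k l ** transpose (\<Phi> l) = \<Phi> k ** ?Q k l ** transpose (\<Phi> l)"
      by (simp only: P[OF that(1) l] Q[OF that] bridge_cov_eq[OF that])
    then have "\<Phi> k ** ?P k l = \<Phi> k ** ?Q k l"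
      by (rule invertible_cancel_right[OF transition_invertible[OF l]])
    then show ?thesis
      by (rule invertible_cancel_left[OF transition_invertible[OF that(1)]])
  qed
  have PT: "transpose (?P k l) = ?P l k" for k l
    unfolding transpose_sum using covariance_matrix_pinned_noise_cov
    by (intro sum.cong) (auto simp: matrix_transpose_mul matrix_mul_assoc covariance_matrix_def)
  have QT: "transpose (?Q k l) = ?Q l k" for k l
    by (simp add: regression_def matrix_algebra gramian_symmetric_inverse free_cov_transpose)
  show ?thesis
  proof (cases "l \<le> k")
    case True
    then show ?thesis using lower assms by blast
  next
    case False
    then have "?P l k = ?Q l k" using lower assms by simp
    then have "transpose (?P l k) = transpose (?Q l k)" by (rule arg_cong)
    then show ?thesis unfolding PT QT .
  qed
qed

text \<open>In random-walk coordinates the free mean is constant, so both sides reduce to affine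
  functions of the initial error \<open>y - \<Phi> 0 *v x0\<close>.\<close>

lemma pinned_drift_eq_conditional_mean:
  assumes "k \<le> N"
  shows "drift (A_hat A B N) (\<lambda>k. (B k ** pinned_gain A B N k) *v y) x0 k =
         drift A (\<lambda>_. 0) x0 k + regression k *v (y - drift A (\<lambda>_. 0) x0 N)" (is "?L = ?R")
proof -
  have free: "\<Phi> k *v drift A (\<lambda>_. 0) x0 k = \<Phi> 0 *v x0" if "k \<le> N" for k
    using drift_transform[of N \<Phi> A "\<lambda>_. mat 1" k "\<lambda>_. 0" x0] that
    by (simp add: transition_step drift_identity)
  have "\<Phi> k *v ?L = drift F (\<lambda>k. \<Phi> (Suc k) *v ((B k ** pinned_gain A B N k) *v y)) (\<Phi> 0 *v x0) k"
    by (rule drift_transform[where N=N]) (use A_hat_transform assms in auto)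
  also have "\<dots> = y - (G k ** Gi 0) *v (y - \<Phi> 0 *v x0)"
    unfolding matrix_vector_mul_assoc transition_pinned_input by (rule bridge_drift[OF assms])
  also have "\<dots> = \<Phi> 0 *v x0 + ((G 0 - G k) ** Gi 0) *v (y - \<Phi> 0 *v x0)"
    by (simp add: matrix_mult_diff_right matrix_vector_mult_diff_rdistrib gramian_inverse)
  also have "\<dots> = \<Phi> k *v ?R"
    using free[OF assms] free[of N]
    by (simp add: matrix_vector_right_distrib matrix_vector_mul_assoc transition_regression assms transition_final)
  finally have eq: "\<Phi> k *v ?L = \<Phi> k *v ?R" .
  obtain T where "T ** \<Phi> k = mat 1" using transition_invertible[OF assms] unfolding invertible_def by blast
  then show ?thesis using arg_cong[OF eq, of "(*v) T"] by (simp add: matrix_vector_mul_assoc)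
qed

end

section \<open>Gaussian noise\<close>

lemma integral_indicator_complex: "(CLINT x|M. indicator A x) = complex_of_real (measure M (A \<inter> space M))"
  unfolding of_real_indicator[symmetric, where 'a=complex] integral_complex_of_real by simp

lemma joint_gaussian_law_unique:
  assumes I: "finite I" and P: "joint_gaussian_law I P m C" and Q: "joint_gaussian_law I Q m C"
  shows "P = Q"
proof -
  interpret P: prob_space P using P by (simp add: joint_gaussian_law_def)
  interpret Q: prob_space Q using Q by (simp add: joint_gaussian_law_def)
  have sets_P [measurable_cong]: "sets P = sets (Pi\<^sub>M I (\<lambda>_. borel))"
    and sets_Q [measurable_cong]: "sets Q = sets (Pi\<^sub>M I (\<lambda>_. borel))"
    using P Q by (auto simp: joint_gaussian_law_def)
  show ?thesis
  proof (rule measure_eqI)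
    fix A assume A: "A \<in> sets P"
    have "(CLINT x|P. 1 * indicator A x) = (CLINT x|Q. 1 * indicator A x)"
    proof (rule fourier_uniqueness_PiM[OF I])
      show "(CLINT x|P. 1 * iexp (\<Sum>i\<in>I. u i \<bullet> x i)) = (CLINT x|Q. 1 * iexp (\<Sum>i\<in>I. u i \<bullet> x i))" for u
        using P Q by (simp only: mult_1 joint_gaussian_law_def)
    qed (use A sets_P in simp_all)
    then have "measure P A = measure Q A"
      using A sets_P sets_Q by (simp add: integral_indicator_complex Int_absorb2[OF sets.sets_into_space])
    then show "emeasure P A = emeasure Q A"
      by (simp add: P.emeasure_eq_measure Q.emeasure_eq_measure)
  qed (simp add: sets_P sets_Q)
qed

lemma joint_gaussian_law_cong:
  assumes "\<And>k. k \<in> I \<Longrightarrow> m k = m' k" and "\<And>k l. k \<in> I \<Longrightarrow> l \<in> I \<Longrightarrow> C k l = C' k l"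
  shows "joint_gaussian_law I P m C \<longleftrightarrow> joint_gaussian_law I P m' C'"
proof -
  have "(\<Sum>k\<in>I. u k \<bullet> m k) = (\<Sum>k\<in>I. u k \<bullet> m' k)"
    "(\<Sum>k\<in>I. \<Sum>l\<in>I. u k \<bullet> (C k l *v u l)) = (\<Sum>k\<in>I. \<Sum>l\<in>I. u k \<bullet> (C' k l *v u l))" for u
    using assms by (auto intro!: sum.cong)
  then show ?thesis unfolding joint_gaussian_law_def by simp
qed

lemma sample_path_measurable [measurable (raw)]:
  assumes "\<And>k. k \<le> n \<Longrightarrow> X k \<in> borel_measurable M"
  shows "sample_path n X \<in> M \<rightarrow>\<^sub>M path_space n"
  unfolding sample_path_def path_space_def using assms by (intro measurable_restrict) auto

locale gaussian_noise = prob_space M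
  for M :: "'a measure" +
  fixes N :: nat and S :: "nat \<Rightarrow> real^'m^'m" and w :: "nat \<Rightarrow> 'a \<Rightarrow> real^'m"
  assumes noise: "independent_gaussian_noise M N S w"
begin

lemma noise_measurable: "j < N \<Longrightarrow> w j \<in> borel_measurable M"
  using noise unfolding independent_gaussian_noise_def indep_vars_def by auto

lemma noise_indep: "indep_vars (\<lambda>_. borel) w {..<N}"
  using noise unfolding independent_gaussian_noise_def by auto

lemma noise_char:
  assumes "j < N"
  shows "(CLINT \<omega>|M. iexp (u \<bullet> w j \<omega>)) = exp (- complex_of_real (u \<bullet> (S j *v u) / 2))"
proof -
  have "gaussian_law (distr M borel (w j)) 0 (S j)"
    using noise assms unfolding independent_gaussian_noise_def by auto
  then have "(CLINT x|distr M borel (w j). iexp (u \<bullet> x)) = exp (- complex_of_real (u \<bullet> (S j *v u) / 2))"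
    unfolding gaussian_law_def by simp
  moreover have "(CLINT x|distr M borel (w j). iexp (u \<bullet> x)) = (CLINT \<omega>|M. iexp (u \<bullet> w j \<omega>))"
    by (rule integral_distr[OF noise_measurable[OF assms]]) measurable
  ultimately show ?thesis by simp
qed

lemma noise_joint_char:
  "(CLINT \<omega>|M. iexp (c + (\<Sum>j<N. v j \<bullet> w j \<omega>))) =
     exp (\<i> * complex_of_real c - complex_of_real ((\<Sum>j<N. v j \<bullet> (S j *v v j)) / 2))"
proof -
  have "(CLINT \<omega>|M. (\<Prod>j<N. iexp (v j \<bullet> w j \<omega>))) = (\<Prod>j<N. CLINT \<omega>|M. iexp (v j \<bullet> w j \<omega>))"
  proof (rule indep_vars_lebesgue_integral)
    show "indep_vars (\<lambda>_. borel) (\<lambda>j \<omega>. iexp (v j \<bullet> w j \<omega>)) {..<N}"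
      by (rule indep_vars_compose2[OF noise_indep]) measurable
    show "integrable M (\<lambda>\<omega>. iexp (v j \<bullet> w j \<omega>))" if "j \<in> {..<N}" for j
    proof (rule integrable_const_bound[where B=1])
      have [measurable]: "w j \<in> borel_measurable M" using that by (simp add: noise_measurable)
      show "(\<lambda>\<omega>. iexp (v j \<bullet> w j \<omega>)) \<in> borel_measurable M" by measurable
    qed simp
  qed simp
  also have "\<dots> = (\<Prod>j<N. exp (- complex_of_real (v j \<bullet> (S j *v v j) / 2)))"
    by (intro prod.cong refl noise_char) simp
  also have "\<dots> = exp (- complex_of_real ((\<Sum>j<N. v j \<bullet> (S j *v v j)) / 2))"
    by (simp add: exp_sum[symmetric] sum_negf sum_divide_distrib)
  finally have "(CLINT \<omega>|M. iexp c * (\<Prod>j<N. iexp (v j \<bullet> w j \<omega>))) =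
      iexp c * exp (- complex_of_real ((\<Sum>j<N. v j \<bullet> (S j *v v j)) / 2))"
    by simp
  moreover have "iexp (c + (\<Sum>j<N. v j \<bullet> w j \<omega>)) = iexp c * (\<Prod>j<N. iexp (v j \<bullet> w j \<omega>))" for \<omega>
    by (simp add: exp_add exp_sum[symmetric] distrib_left sum_distrib_left)
  ultimately show ?thesis by (simp add: exp_add[symmetric])
qed

text \<open>Testing the path against \<open>u\<close> gives a constant plus a sum over the noises,
  where \<open>v j\<close> collects everything that multiplies \<open>w j\<close>. The
  characteristic function of the independent noises then yields the joint law at once, for singular
  \<open>S j\<close> as well.\<close>

lemma joint_gaussian_law_affine:
  fixes Z :: "nat \<Rightarrow> 'a \<Rightarrow> real^'n"
  assumes Z: "\<And>k. k \<le> n \<Longrightarrow> Z k \<in> borel_measurable M"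
    and eq: "\<And>k. k \<le> n \<Longrightarrow> AE \<omega> in M. Z k \<omega> = a k + (\<Sum>j<N. H k j *v w j \<omega>)"
  shows "joint_gaussian_law {..n} (distr M (path_space n) (sample_path n Z)) a
     (\<lambda>k l. \<Sum>j<N. H k j ** S j ** transpose (H l j))"
  unfolding joint_gaussian_law_def
proof (intro conjI allI)
  have Zm: "sample_path n Z \<in> M \<rightarrow>\<^sub>M path_space n" by (rule sample_path_measurable[OF Z])
  show "prob_space (distr M (path_space n) (sample_path n Z))"
    by (rule prob_space_distr[OF Zm])
  show "sets (distr M (path_space n) (sample_path n Z)) = sets (Pi\<^sub>M {..n} (\<lambda>_. borel))"
    by (simp add: path_space_def)
  fix u :: "nat \<Rightarrow> real^'n"
  define v where "v j = (\<Sum>k\<le>n. transpose (H k j) *v u k)" for j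
  have [measurable]: "(\<lambda>x. \<Sum>k\<le>n. u k \<bullet> x k) \<in> borel_measurable (path_space n)"
    unfolding path_space_def
    by (intro borel_measurable_sum borel_measurable_inner borel_measurable_const measurable_component_singleton) simp
  have [measurable]: "(\<lambda>\<omega>. \<Sum>k\<le>n. u k \<bullet> Z k \<omega>) \<in> borel_measurable M"
    by (intro borel_measurable_sum borel_measurable_inner borel_measurable_const Z) simp
  have [measurable]: "(\<lambda>\<omega>. \<Sum>j<N. v j \<bullet> w j \<omega>) \<in> borel_measurable M"
    by (intro borel_measurable_sum borel_measurable_inner borel_measurable_const noise_measurable) simp
  have "(CLINT x|distr M (path_space n) (sample_path n Z). iexp (\<Sum>k\<le>n. u k \<bullet> x k)) =
      (CLINT \<omega>|M. iexp (\<Sum>k\<le>n. u k \<bullet> sample_path n Z \<omega> k))"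
    by (rule integral_distr[OF Zm]) measurable
  also have "\<dots> = (CLINT \<omega>|M. iexp (\<Sum>k\<le>n. u k \<bullet> Z k \<omega>))"
    by (simp add: sample_path_def)
  also have "\<dots> = (CLINT \<omega>|M. iexp ((\<Sum>k\<le>n. u k \<bullet> a k) + (\<Sum>j<N. v j \<bullet> w j \<omega>)))"
  proof (rule integral_cong_AE)
    have "AE \<omega> in M. \<forall>k\<in>{..n}. Z k \<omega> = a k + (\<Sum>j<N. H k j *v w j \<omega>)"
      by (rule AE_finite_allI) (auto intro: eq)
    then show "AE \<omega> in M. iexp (\<Sum>k\<le>n. u k \<bullet> Z k \<omega>) = iexp ((\<Sum>k\<le>n. u k \<bullet> a k) + (\<Sum>j<N. v j \<bullet> w j \<omega>))"
    proof eventually_elim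
      case (elim \<omega>)
      have "(\<Sum>k\<le>n. u k \<bullet> Z k \<omega>) = (\<Sum>k\<le>n. u k \<bullet> a k + (\<Sum>j<N. (transpose (H k j) *v u k) \<bullet> w j \<omega>))"
        using elim by (intro sum.cong refl)
          (simp only: inner_add_right inner_sum_right inner_matrix_vector)
      also have "\<dots> = (\<Sum>k\<le>n. u k \<bullet> a k) + (\<Sum>j<N. v j \<bullet> w j \<omega>)"
        unfolding sum.distrib v_def inner_sum_left by (subst sum.swap) (rule refl)
      finally show ?case by (rule arg_cong)
    qed
  qed measurable
  also have "\<dots> = exp (\<i> * complex_of_real (\<Sum>k\<le>n. u k \<bullet> a k) - complex_of_real ((\<Sum>j<N. v j \<bullet> (S j *v v j)) / 2))"
    by (rule noise_joint_char)
  also have "(\<Sum>j<N. v j \<bullet> (S j *v v j)) =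
      (\<Sum>k\<le>n. \<Sum>l\<le>n. u k \<bullet> ((\<Sum>j<N. H k j ** S j ** transpose (H l j)) *v u l))"
  proof -
    have "v j \<bullet> (S j *v v j) = (\<Sum>k\<le>n. \<Sum>l\<le>n. u k \<bullet> ((H k j ** S j ** transpose (H l j)) *v u l))" for j
    proof -
      have "v j \<bullet> (S j *v v j) = (\<Sum>k\<le>n. \<Sum>l\<le>n. (transpose (H k j) *v u k) \<bullet> (S j *v (transpose (H l j) *v u l)))"
        unfolding v_def vec.sum inner_sum_left inner_sum_right by (rule sum.swap)
      then show ?thesis
        by (simp only: inner_matrix_vector[symmetric] matrix_vector_mul_assoc matrix_mul_assoc)
    qed
    then have "(\<Sum>j<N. v j \<bullet> (S j *v v j)) =
      (\<Sum>j<N. \<Sum>k\<le>n. \<Sum>l\<le>n. u k \<bullet> ((H k j ** S j ** transpose (H l j)) *v u l))"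
      by simp
    also have "\<dots> = (\<Sum>k\<le>n. \<Sum>j<N. \<Sum>l\<le>n. u k \<bullet> ((H k j ** S j ** transpose (H l j)) *v u l))"
      by (rule sum.swap)
    also have "\<dots> = (\<Sum>k\<le>n. \<Sum>l\<le>n. \<Sum>j<N. u k \<bullet> ((H k j ** S j ** transpose (H l j)) *v u l))"
      by (intro sum.cong refl sum.swap)
    finally show ?thesis by (simp only: matrix_sum_vector inner_sum_right)
  qed
  finally show "(CLINT x|distr M (path_space n) (sample_path n Z). iexp (\<Sum>k\<le>n. u k \<bullet> x k)) =
     exp (\<i> * complex_of_real (\<Sum>k\<le>n. u k \<bullet> a k) -
       complex_of_real ((\<Sum>k\<le>n. \<Sum>l\<le>n. u k \<bullet> ((\<Sum>j<N. H k j ** S j ** transpose (H l j)) *v u l)) / 2))" .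
qed

end

lemma recursion_solution:
  fixes x :: "nat \<Rightarrow> 'a \<Rightarrow> real^'n"
  assumes init: "AE \<omega> in M. x 0 \<omega> = x0"
    and step: "\<And>k. k < N \<Longrightarrow> AE \<omega> in M. x (Suc k) \<omega> = F k *v x k \<omega> + b k + B k *v w k \<omega>"
    and "k \<le> N"
  shows "AE \<omega> in M. x k \<omega> = drift F b x0 k + (\<Sum>j<N. noise_gain F B k j *v w j \<omega>)"
  using \<open>k \<le> N\<close>
proof (induction k)
  case 0
  then show ?case using init by simp
next
  case (Suc k)
  then have k: "k < N" by simp
  from step[OF k] Suc.IH[OF less_imp_le[OF k]] show ?case
  proof eventually_elim
    case (elim \<omega>)
    have "(\<Sum>j<N. (if j = k then B k else 0) *v w j \<omega>) = (\<Sum>j<N. if j = k then B k *v w j \<omega> else 0)"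
      by (intro sum.cong) auto
    also have "\<dots> = B k *v w k \<omega>" using k by simp
    finally have last: "(\<Sum>j<N. (if j = k then B k else 0) *v w j \<omega>) = B k *v w k \<omega>" .
    show ?case
      unfolding elim drift.simps noise_gain.simps matrix_vector_mult_add_rdistrib sum.distrib last
      by (simp add: matrix_vector_right_distrib vec.sum matrix_vector_mul_assoc)
  qed
qed

text \<open>The conditional law is expressed through expectations and cross covariances of the free
  process, whereas the noise is specified by characteristic functions. The moments have to be
  recovered from these.\<close>

locale standard_gaussian_noise = gaussian_noise M N "\<lambda>_. mat 1" w
  for M :: "'a measure" and N :: nat and w :: "nat \<Rightarrow> 'a \<Rightarrow> real^'m"
begin

text \<open>Projection on a unit vector reduces the question to the real line, where Levy's
  uniqueness theorem identifies the law with one whose moments are known.\<close>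

lemma distr_unit_direction:
  assumes j: "j < N" and u: "u \<bullet> u = 1"
  shows "distr M borel (\<lambda>\<omega>. u \<bullet> w j \<omega>) = std_normal_distribution"
proof (rule Levy_uniqueness)
  have [measurable]: "w j \<in> borel_measurable M" by (rule noise_measurable[OF j])
  show "real_distribution (distr M borel (\<lambda>\<omega>. u \<bullet> w j \<omega>))"
    by (rule real_distribution_distr) measurable
  show "real_distribution std_normal_distribution" by (rule real_dist_normal_dist)
  show "char (distr M borel (\<lambda>\<omega>. u \<bullet> w j \<omega>)) = char std_normal_distribution"
  proof
    fix t :: real
    have "char (distr M borel (\<lambda>\<omega>. u \<bullet> w j \<omega>)) t = (CLINT \<omega>|M. iexp ((t *\<^sub>R u) \<bullet> w j \<omega>))"
      unfolding char_def by (subst integral_distr) auto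
    also have "\<dots> = exp (- complex_of_real (t\<^sup>2 / 2))"
      unfolding noise_char[OF j] by (simp add: u power2_eq_square)
    also have "\<dots> = char std_normal_distribution t"
      unfolding char_std_normal_distribution by (simp add: exp_of_real[symmetric])
    finally show "char (distr M borel (\<lambda>\<omega>. u \<bullet> w j \<omega>)) t = char std_normal_distribution t" .
  qed
qed

lemma direction_moments:
  assumes j: "j < N"
  shows "integrable M (\<lambda>\<omega>. u \<bullet> w j \<omega>)" "(LINT \<omega>|M. u \<bullet> w j \<omega>) = 0"
    "integrable M (\<lambda>\<omega>. (u \<bullet> w j \<omega>)\<^sup>2)" "(LINT \<omega>|M. (u \<bullet> w j \<omega>)\<^sup>2) = u \<bullet> u"
proof -
  have [measurable]: "w j \<in> borel_measurable M" by (rule noise_measurable[OF j])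
  have unit: "integrable M (\<lambda>\<omega>. (e \<bullet> w j \<omega>) ^ k) \<and>
     (LINT \<omega>|M. (e \<bullet> w j \<omega>) ^ k) = (LINT x|std_normal_distribution. x ^ k)" if "e \<bullet> e = 1" for e k
  proof -
    have "integrable (distr M borel (\<lambda>\<omega>. e \<bullet> w j \<omega>)) (\<lambda>x. x ^ k)"
      unfolding distr_unit_direction[OF j that] by (rule integrable_std_normal_distribution_moment)
    then have "integrable M (\<lambda>\<omega>. (e \<bullet> w j \<omega>) ^ k)" by (subst (asm) integrable_distr_eq) auto
    moreover have "(LINT x|distr M borel (\<lambda>\<omega>. e \<bullet> w j \<omega>). x ^ k) = (LINT \<omega>|M. (e \<bullet> w j \<omega>) ^ k)"
      by (rule integral_distr) auto
    ultimately show ?thesis unfolding distr_unit_direction[OF j that] by simp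
  qed
  \<comment> \<open>For \<open>u = 0\<close> any unit vector will do, because the factor
    \<open>norm u\<close> vanishes.\<close>
  define e where "e = (if u = 0 then axis undefined 1 else u /\<^sub>R norm u)"
  have e: "e \<bullet> e = 1" and u: "u = norm u *\<^sub>R e"
    by (auto simp: e_def norm_eq_sqrt_inner inner_axis_axis)
       (simp add: norm_eq_sqrt_inner[symmetric] power2_norm_eq_inner[symmetric] power2_eq_square divide_simps)
  have eq: "u \<bullet> w j \<omega> = norm u * (e \<bullet> w j \<omega>)" for \<omega>
    by (subst u) simp
  show "integrable M (\<lambda>\<omega>. u \<bullet> w j \<omega>)" unfolding eq using unit[OF e, of 1] by simp
  show "(LINT \<omega>|M. u \<bullet> w j \<omega>) = 0" unfolding eq
    using unit[OF e, of 1] integral_std_normal_distribution_moment_odd[of 1] by simp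
  show "integrable M (\<lambda>\<omega>. (u \<bullet> w j \<omega>)\<^sup>2)" unfolding eq power_mult_distrib
    using unit[OF e, of 2] by simp
  have "(LINT x|std_normal_distribution. x\<^sup>2) = 1"
    using std_normal_distribution_even_moments(1)[of 1] by simp
  then show "(LINT \<omega>|M. (u \<bullet> w j \<omega>)\<^sup>2) = u \<bullet> u" unfolding eq power_mult_distrib
    using unit[OF e, of 2] by (simp add: power2_norm_eq_inner)
qed

lemma product_moment:
  assumes j: "j < N" and l: "l < N"
  shows "integrable M (\<lambda>\<omega>. (a \<bullet> w j \<omega>) * (b \<bullet> w l \<omega>))"
    and "(LINT \<omega>|M. (a \<bullet> w j \<omega>) * (b \<bullet> w l \<omega>)) = (if j = l then a \<bullet> b else 0)"
proof -
  have "integrable M (\<lambda>\<omega>. (a \<bullet> w j \<omega>) * (b \<bullet> w l \<omega>)) \<and>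
     (LINT \<omega>|M. (a \<bullet> w j \<omega>) * (b \<bullet> w l \<omega>)) = (if j = l then a \<bullet> b else 0)"
  proof (cases "j = l")
    case True
    \<comment> \<open>Polarization reduces products at the same time to second moments in the
      directions \<open>a + b\<close> and \<open>a - b\<close>.\<close>
    have eq: "(a \<bullet> w j \<omega>) * (b \<bullet> w l \<omega>) = (((a + b) \<bullet> w j \<omega>)\<^sup>2 - ((a - b) \<bullet> w j \<omega>)\<^sup>2) / 4" for \<omega>
      by (simp add: True inner_add_left inner_diff_left power2_eq_square algebra_simps)
    show ?thesis unfolding eq
      using direction_moments(3,4)[OF j, of "a + b"] direction_moments(3,4)[OF j, of "a - b"]
      by (simp add: True inner_add_left inner_diff_left inner_add_right inner_diff_right inner_commute)
  next
    case False
    define X where "X i \<omega> = (if i = j then a else b) \<bullet> w i \<omega>" for i \<omega>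
    have "indep_vars (\<lambda>_. borel) X {j, l}"
      unfolding X_def by (rule indep_vars_compose2[OF indep_vars_subset[OF noise_indep]]) (use j l in auto)
    moreover have "integrable M (X i)" if "i \<in> {j, l}" for i
      unfolding X_def using that j l by (auto intro: direction_moments)
    ultimately have "integrable M (\<lambda>\<omega>. \<Prod>i\<in>{j, l}. X i \<omega>)"
      "(LINT \<omega>|M. (\<Prod>i\<in>{j, l}. X i \<omega>)) = (\<Prod>i\<in>{j, l}. LINT \<omega>|M. X i \<omega>)"
      by (auto intro!: indep_vars_integrable indep_vars_lebesgue_integral)
    then show ?thesis using False direction_moments(2)[OF j] by (simp add: X_def)
  qed
  then show "integrable M (\<lambda>\<omega>. (a \<bullet> w j \<omega>) * (b \<bullet> w l \<omega>))"
    and "(LINT \<omega>|M. (a \<bullet> w j \<omega>) * (b \<bullet> w l \<omega>)) = (if j = l then a \<bullet> b else 0)" by auto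
qed

lemma noise_integrable:
  assumes "j < N"
  shows "integrable M (w j)" and "integral\<^sup>L M (w j) = 0"
proof -
  have "integrable M (\<lambda>\<omega>. \<Sum>b\<in>Basis. (b \<bullet> w j \<omega>) *\<^sub>R b)"
    by (intro Bochner_Integration.integrable_sum integrable_scaleR_left impI direction_moments assms)
  then show *: "integrable M (w j)" by (simp add: inner_commute[of _ "w j _"] euclidean_representation)
  show "integral\<^sup>L M (w j) = 0"
  proof (rule vector_eq_rdot[THEN iffD1, rule_format])
    show "integral\<^sup>L M (w j) \<bullet> u = 0 \<bullet> u" for u
      using integral_inner_right[OF *, of u] direction_moments(2)[OF assms, of u] by (simp add: inner_commute)
  qed
qed

lemma expectation_affine:
  fixes X :: "'a \<Rightarrow> real^'n"
  assumes [measurable]: "X \<in> borel_measurable M" and X: "AE \<omega> in M. X \<omega> = a + (\<Sum>j<N. H j *v w j \<omega>)"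
  shows "integral\<^sup>L M X = a"
proof -
  have int: "integrable M (\<lambda>\<omega>. H j *v w j \<omega>)" "(LINT \<omega>|M. H j *v w j \<omega>) = 0" if "j < N" for j
    using integrable_bounded_linear[OF matrix_vector_mul_bounded_linear noise_integrable(1)[OF that]]
      integral_bounded_linear[OF matrix_vector_mul_bounded_linear noise_integrable(1)[OF that]]
      noise_integrable(2)[OF that] by auto
  have sum_int: "integrable M (\<lambda>\<omega>. \<Sum>j<N. H j *v w j \<omega>)"
    by (intro Bochner_Integration.integrable_sum int) simp
  then have "integrable M (\<lambda>\<omega>. a + (\<Sum>j<N. H j *v w j \<omega>))"
    by (intro Bochner_Integration.integrable_add integrable_const)
  then have "integral\<^sup>L M X = (LINT \<omega>|M. a + (\<Sum>j<N. H j *v w j \<omega>))"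
    by (intro integral_cong_AE[OF assms(1) _ X] borel_measurable_integrable)
  also have "\<dots> = a + (\<Sum>j<N. LINT \<omega>|M. H j *v w j \<omega>)"
    using int sum_int by (simp add: Bochner_Integration.integral_sum prob_space)
  finally show ?thesis using int by simp
qed

lemma cross_covariance_affine:
  fixes X :: "'a \<Rightarrow> real^'n" and Y :: "'a \<Rightarrow> real^'k"
  assumes [measurable]: "X \<in> borel_measurable M" and X: "AE \<omega> in M. X \<omega> = a + (\<Sum>j<N. H j *v w j \<omega>)"
    and [measurable]: "Y \<in> borel_measurable M" and Y: "AE \<omega> in M. Y \<omega> = b + (\<Sum>j<N. K j *v w j \<omega>)"
  shows "cross_covariance M X Y = (\<Sum>j<N. H j ** transpose (K j))"
proof -
  have "(LINT \<omega>|M. (X \<omega> - a) $ i * (Y \<omega> - b) $ q) = (\<Sum>j<N. H j ** transpose (K j)) $ i $ q" for i q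
  proof -
    have [measurable]: "(\<lambda>\<omega>. \<Sum>j<N. \<Sum>l<N. (H j $ i \<bullet> w j \<omega>) * (K l $ q \<bullet> w l \<omega>)) \<in> borel_measurable M"
      by (intro borel_measurable_sum borel_measurable_times borel_measurable_inner borel_measurable_const
           noise_measurable) auto
    have "(LINT \<omega>|M. (X \<omega> - a) $ i * (Y \<omega> - b) $ q) =
      (LINT \<omega>|M. (\<Sum>j<N. \<Sum>l<N. (H j $ i \<bullet> w j \<omega>) * (K l $ q \<bullet> w l \<omega>)))"
    proof (rule integral_cong_AE)
      from X Y show "AE \<omega> in M. (X \<omega> - a) $ i * (Y \<omega> - b) $ q = (\<Sum>j<N. \<Sum>l<N. (H j $ i \<bullet> w j \<omega>) * (K l $ q \<bullet> w l \<omega>))"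
        by eventually_elim (simp add: matrix_vector_mul_component sum_product)
      show "(\<lambda>\<omega>. (X \<omega> - a) $ i * (Y \<omega> - b) $ q) \<in> borel_measurable M"
        by (intro borel_measurable_times measurable_compose[OF _ borel_measurable_nth]) measurable
    qed simp
    also have "\<dots> = (\<Sum>j<N. \<Sum>l<N. LINT \<omega>|M. (H j $ i \<bullet> w j \<omega>) * (K l $ q \<bullet> w l \<omega>))"
      by (subst Bochner_Integration.integral_sum) (auto intro!: product_moment sum.cong Bochner_Integration.integral_sum)
    also have "\<dots> = (\<Sum>j<N. \<Sum>l<N. if j = l then H j $ i \<bullet> K l $ q else 0)"
      by (intro sum.cong refl product_moment) auto
    also have "\<dots> = (\<Sum>j<N. H j ** transpose (K j)) $ i $ q"
      by (simp add: matrix_matrix_mult_def transpose_def inner_vec_def)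
    finally show ?thesis .
  qed
  then show ?thesis
    unfolding cross_covariance_def expectation_affine[OF assms(1,2)] expectation_affine[OF assms(3,4)]
    by (simp add: vec_eq_iff)
qed

end

section \<open>Conditioning on the final state\<close>

lemma integral_indicator_comp:
  "(CLINT \<omega>|M. indicator U (g \<omega>)) = complex_of_real (measure M {\<omega> \<in> space M. g \<omega> \<in> U})"
proof -
  have "(CLINT \<omega>|M. indicator U (g \<omega>)) = (CLINT \<omega>|M. indicator {\<omega> \<in> space M. g \<omega> \<in> U} \<omega>)"
    by (intro Bochner_Integration.integral_cong refl) (simp add: indicator_def)
  then show ?thesis by (simp add: integral_indicator_complex Int_def conj_commute)
qed

locale driven_system = reachable_system A B N + standard_gaussian_noise M N w
  for A :: "nat \<Rightarrow> real^'n^'n" and B :: "nat \<Rightarrow> real^'m^'n" and N :: nat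
    and M :: "'a measure" and w :: "nat \<Rightarrow> 'a \<Rightarrow> real^'m" +
  fixes x0 :: "real^'n" and x :: "nat \<Rightarrow> 'a \<Rightarrow> real^'n"
  assumes x_measurable: "\<And>k. k \<le> N \<Longrightarrow> x k \<in> borel_measurable M"
    and x_init: "AE \<omega> in M. x 0 \<omega> = x0"
    and x_step: "\<And>k. k < N \<Longrightarrow> AE \<omega> in M. x (Suc k) \<omega> = A k *v x k \<omega> + B k *v w k \<omega>"
begin

abbreviation "H \<equiv> noise_gain A B"
abbreviation "mean \<equiv> drift A (\<lambda>_. 0) x0"

lemma x_solution: "k \<le> N \<Longrightarrow> AE \<omega> in M. x k \<omega> = mean k + (\<Sum>j<N. H k j *v w j \<omega>)"
  by (rule recursion_solution[where x=x]) (use x_init x_step in auto)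

lemma expectation_x: "k \<le> N \<Longrightarrow> integral\<^sup>L M (x k) = mean k"
  by (rule expectation_affine[OF x_measurable x_solution])

lemma cross_covariance_x: "k \<le> N \<Longrightarrow> l \<le> N \<Longrightarrow> cross_covariance M (x k) (x l) = free_cov k l"
  unfolding free_cov_def by (rule cross_covariance_affine[OF x_measurable x_solution x_measurable x_solution])

section \<open>The regression residual and its independence of the final state\<close>

definition "residual k \<omega> = x k \<omega> - regression k *v x N \<omega>"

lemma residual_measurable: "k \<le> N \<Longrightarrow> residual k \<in> borel_measurable M"
  unfolding residual_def[abs_def]
  by (intro borel_measurable_diff x_measurable order_refl
      measurable_compose[OF x_measurable borel_measurable_continuous_onI] linear_continuous_on
      matrix_vector_mul_bounded_linear)

lemma residual_path_measurable: "sample_path N residual \<in> M \<rightarrow>\<^sub>M path_space N"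
  by (rule sample_path_measurable[OF residual_measurable])

definition "residual_gain k j = H k j - regression k ** H N j"

lemma residual_solution:
  assumes "k \<le> N"
  shows "AE \<omega> in M. residual k \<omega> = (mean k - regression k *v mean N) + (\<Sum>j<N. residual_gain k j *v w j \<omega>)"
  using x_solution[OF assms] x_solution[OF order_refl]
  by eventually_elim
     (simp add: residual_def residual_gain_def matrix_vector_right_distrib vec.sum matrix_vector_mul_assoc
        matrix_vector_mult_diff_rdistrib sum_subtractf)

text \<open>The normal equation of the regression, from which the vanishing correlation
  follows.\<close>

lemma regression_free_cov: "regression k ** free_cov N N = free_cov k N"
  by (simp add: regression_def free_cov_final matrix_mul_assoc[symmetric] gramian_inverse)

lemma residual_uncorrelated: "(\<Sum>j<N. residual_gain k j ** transpose (H N j)) = 0"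
  using regression_free_cov[of k]
  by (simp add: residual_gain_def matrix_mult_diff_right sum_subtractf free_cov_def matrix_mult_sum_left
      matrix_mul_assoc)

lemma residual_cov:
  "(\<Sum>j<N. residual_gain k j ** transpose (residual_gain l j)) = free_cov k l - regression k ** free_cov N l"
proof -
  \<comment> \<open>Expanding the second factor alone suffices: its component along the final state
    is uncorrelated with the first factor.\<close>
  have "(\<Sum>j<N. residual_gain k j ** transpose (residual_gain l j)) =
     (\<Sum>j<N. residual_gain k j ** transpose (H l j)) - (\<Sum>j<N. residual_gain k j ** transpose (H N j)) ** transpose (regression l)"
    unfolding residual_gain_def[of l] matrix_mult_sum_right
    by (simp add: transpose_diff matrix_transpose_mul matrix_mult_diff_left matrix_mul_assoc sum_subtractf)
  also have "\<dots> = free_cov k l - regression k ** free_cov N l"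
    unfolding residual_uncorrelated
    by (simp add: residual_gain_def matrix_mult_diff_right sum_subtractf free_cov_def matrix_mult_sum_left
        matrix_mul_assoc)
  finally show ?thesis .
qed

text \<open>Both phases are affine in the noises, with coefficients \<open>p\<close> and
  \<open>q\<close>. The Gaussian exponent of the sum splits because the cross term, the sum of the
  \<open>p j \<bullet> q j\<close>, is a combination of the vanishing correlations.\<close>

lemma residual_joint_char:
  "(CLINT \<omega>|M. iexp (\<Sum>k\<le>N. u k \<bullet> residual k \<omega>) * iexp (t \<bullet> x N \<omega>)) =
   (CLINT \<omega>|M. iexp (\<Sum>k\<le>N. u k \<bullet> residual k \<omega>)) * (CLINT \<omega>|M. iexp (t \<bullet> x N \<omega>))"
proof -
  define c where "c = (\<Sum>k\<le>N. u k \<bullet> (mean k - regression k *v mean N))"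
  define p where "p j = (\<Sum>k\<le>N. transpose (residual_gain k j) *v u k)" for j
  define d where "d = t \<bullet> mean N"
  define q where "q j = transpose (H N j) *v t" for j
  have "AE \<omega> in M. \<forall>k\<in>{..N}. residual k \<omega> = (mean k - regression k *v mean N) + (\<Sum>j<N. residual_gain k j *v w j \<omega>)"
    by (rule AE_finite_allI) (auto intro: residual_solution)
  then have R: "AE \<omega> in M. (\<Sum>k\<le>N. u k \<bullet> residual k \<omega>) = c + (\<Sum>j<N. p j \<bullet> w j \<omega>)"
  proof eventually_elim
    case (elim \<omega>)
    have "(\<Sum>k\<le>N. u k \<bullet> residual k \<omega>) =
       (\<Sum>k\<le>N. u k \<bullet> (mean k - regression k *v mean N) + (\<Sum>j<N. (transpose (residual_gain k j) *v u k) \<bullet> w j \<omega>))"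
      using elim by (intro sum.cong refl) (simp only: inner_add_right inner_sum_right inner_matrix_vector)
    also have "\<dots> = c + (\<Sum>j<N. p j \<bullet> w j \<omega>)"
      unfolding sum.distrib p_def c_def inner_sum_left by (subst sum.swap) (rule refl)
    finally show ?case .
  qed
  have T: "AE \<omega> in M. t \<bullet> x N \<omega> = d + (\<Sum>j<N. q j \<bullet> w j \<omega>)"
    using x_solution[OF order_refl]
  proof eventually_elim
    case (elim \<omega>)
    show ?case unfolding elim d_def q_def
      by (simp only: inner_add_right inner_sum_right inner_matrix_vector)
  qed
  have Rm [measurable]: "(\<lambda>\<omega>. \<Sum>k\<le>N. u k \<bullet> residual k \<omega>) \<in> borel_measurable M"
    by (intro borel_measurable_sum borel_measurable_inner borel_measurable_const residual_measurable) simp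
  have Tm [measurable]: "(\<lambda>\<omega>. t \<bullet> x N \<omega>) \<in> borel_measurable M"
    by (intro borel_measurable_inner borel_measurable_const x_measurable) simp
  have wm [measurable]: "(\<lambda>\<omega>. \<Sum>j<N. v j \<bullet> w j \<omega>) \<in> borel_measurable M" for v
    by (intro borel_measurable_sum borel_measurable_inner borel_measurable_const noise_measurable) simp
  have "(CLINT \<omega>|M. iexp (\<Sum>k\<le>N. u k \<bullet> residual k \<omega>) * iexp (t \<bullet> x N \<omega>)) =
     (CLINT \<omega>|M. iexp ((c + d) + (\<Sum>j<N. (p j + q j) \<bullet> w j \<omega>)))"
  proof (rule integral_cong_AE)
    from R T show "AE \<omega> in M. iexp (\<Sum>k\<le>N. u k \<bullet> residual k \<omega>) * iexp (t \<bullet> x N \<omega>) =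
        iexp ((c + d) + (\<Sum>j<N. (p j + q j) \<bullet> w j \<omega>))"
    proof eventually_elim
      case (elim \<omega>)
      show ?case unfolding elim exp_add[symmetric] distrib_left[symmetric] of_real_add[symmetric]
          inner_add_left sum.distrib by (simp only: ac_simps)
    qed
  qed measurable
  also have "\<dots> = exp (\<i> * complex_of_real (c + d) - complex_of_real ((\<Sum>j<N. (p j + q j) \<bullet> (p j + q j)) / 2))"
    using noise_joint_char[of "c + d" "\<lambda>j. p j + q j"] by simp
  also have "(\<Sum>j<N. (p j + q j) \<bullet> (p j + q j)) = (\<Sum>j<N. p j \<bullet> p j) + (\<Sum>j<N. q j \<bullet> q j)"
  proof -
    have "(\<Sum>j<N. p j \<bullet> q j) = (\<Sum>j<N. \<Sum>k\<le>N. u k \<bullet> ((residual_gain k j ** transpose (H N j)) *v t))"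
      unfolding p_def q_def inner_sum_left
      by (simp only: inner_matrix_vector[symmetric] matrix_vector_mul_assoc)
    also have "\<dots> = (\<Sum>k\<le>N. u k \<bullet> ((\<Sum>j<N. residual_gain k j ** transpose (H N j)) *v t))"
      by (subst sum.swap) (simp only: matrix_sum_vector inner_sum_right)
    also have "\<dots> = 0" by (simp add: residual_uncorrelated)
    finally have "(\<Sum>j<N. p j \<bullet> q j) = 0" .
    then show ?thesis
      by (simp add: inner_add_left inner_add_right sum.distrib inner_commute flip: sum_distrib_left)
  qed
  also have "exp (\<i> * complex_of_real (c + d) - complex_of_real (((\<Sum>j<N. p j \<bullet> p j) + (\<Sum>j<N. q j \<bullet> q j)) / 2)) =
      exp (\<i> * complex_of_real c - complex_of_real ((\<Sum>j<N. p j \<bullet> p j) / 2)) *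
      exp (\<i> * complex_of_real d - complex_of_real ((\<Sum>j<N. q j \<bullet> q j) / 2))"
    unfolding exp_add[symmetric] add_divide_distrib of_real_add by (simp only: distrib_left add_diff_add)
  also have "exp (\<i> * complex_of_real c - complex_of_real ((\<Sum>j<N. p j \<bullet> p j) / 2)) =
      (CLINT \<omega>|M. iexp (c + (\<Sum>j<N. p j \<bullet> w j \<omega>)))"
    using noise_joint_char[of c p] by simp
  also have "\<dots> = (CLINT \<omega>|M. iexp (\<Sum>k\<le>N. u k \<bullet> residual k \<omega>))"
  proof (rule integral_cong_AE)
    show "AE \<omega> in M. iexp (c + (\<Sum>j<N. p j \<bullet> w j \<omega>)) = iexp (\<Sum>k\<le>N. u k \<bullet> residual k \<omega>)"
      using R by eventually_elim (simp only:)
  qed measurable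
  also have "exp (\<i> * complex_of_real d - complex_of_real ((\<Sum>j<N. q j \<bullet> q j) / 2)) =
      (CLINT \<omega>|M. iexp (d + (\<Sum>j<N. q j \<bullet> w j \<omega>)))"
    using noise_joint_char[of d q] by simp
  also have "\<dots> = (CLINT \<omega>|M. iexp (t \<bullet> x N \<omega>))"
  proof (rule integral_cong_AE)
    show "AE \<omega> in M. iexp (d + (\<Sum>j<N. q j \<bullet> w j \<omega>)) = iexp (t \<bullet> x N \<omega>)"
      using T by eventually_elim (simp only:)
  qed measurable
  finally show ?thesis .
qed

text \<open>Fourier uniqueness is used twice. In the variable \<open>x N\<close> it compares the
  weight given by a character of the residual with its constant mean \<open>?c\<close>; in the
  residual path it compares the weight \<open>indicator V (x N \<omega>)\<close> with its constant
  probability.\<close>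

lemma residual_independent:
  assumes U: "U \<in> sets (path_space N)" and V: "V \<in> sets borel"
  shows "prob {\<omega> \<in> space M. sample_path N residual \<omega> \<in> U \<and> x N \<omega> \<in> V} =
     prob {\<omega> \<in> space M. sample_path N residual \<omega> \<in> U} * prob {\<omega> \<in> space M. x N \<omega> \<in> V}"
proof -
  let ?R = "sample_path N residual"
  have [measurable]: "x N \<in> borel_measurable M" by (rule x_measurable) simp
  note [measurable] = residual_path_measurable U V
  have Rm [measurable]: "(\<lambda>\<omega>. \<Sum>k\<le>N. u k \<bullet> residual k \<omega>) \<in> borel_measurable M" for u
    by (intro borel_measurable_sum borel_measurable_inner borel_measurable_const residual_measurable) simp
  have ind: "(CLINT \<omega>|M. indicator V (x N \<omega>)) = complex_of_real (prob {\<omega> \<in> space M. x N \<omega> \<in> V})"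
    "(CLINT \<omega>|M. indicator U (?R \<omega>)) = complex_of_real (prob {\<omega> \<in> space M. ?R \<omega> \<in> U})"
    "(CLINT \<omega>|M. indicator V (x N \<omega>) * indicator U (?R \<omega>)) =
       complex_of_real (prob {\<omega> \<in> space M. ?R \<omega> \<in> U \<and> x N \<omega> \<in> V})"
    using integral_indicator_comp[of M "U \<times> V" "\<lambda>\<omega>. (?R \<omega>, x N \<omega>)"]
    by (simp_all add: integral_indicator_comp indicator_times mult.commute)
  have step: "(CLINT \<omega>|M. indicator V (x N \<omega>) * iexp (\<Sum>k\<le>N. u k \<bullet> residual k \<omega>)) =
      complex_of_real (prob {\<omega> \<in> space M. x N \<omega> \<in> V}) * (CLINT \<omega>|M. iexp (\<Sum>k\<le>N. u k \<bullet> residual k \<omega>))" for u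
  proof -
    let ?c = "CLINT \<omega>|M. iexp (\<Sum>k\<le>N. u k \<bullet> residual k \<omega>)"
    interpret equal_fourier_integrals M M "\<lambda>\<omega>. iexp (\<Sum>k\<le>N. u k \<bullet> residual k \<omega>)" "\<lambda>_. ?c" "x N" "x N"
    proof unfold_locales
      show "integrable M (\<lambda>\<omega>. iexp (\<Sum>k\<le>N. u k \<bullet> residual k \<omega>))"
      proof (rule integrable_const_bound[where B=1])
        show "(\<lambda>\<omega>. iexp (\<Sum>k\<le>N. u k \<bullet> residual k \<omega>)) \<in> borel_measurable M" by measurable
      qed simp
      show "(CLINT \<omega>|M. iexp (\<Sum>k\<le>N. u k \<bullet> residual k \<omega>) * iexp (t \<bullet> x N \<omega>)) = (CLINT \<omega>|M. ?c * iexp (t \<bullet> x N \<omega>))" for t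
        unfolding residual_joint_char by simp
    qed auto
    show ?thesis using integral_indicator_borel[OF V] ind(1) by (simp add: mult.commute)
  qed
  have "(CLINT \<omega>|M. indicator V (x N \<omega>) * indicator U (?R \<omega>)) =
      (CLINT \<omega>|M. complex_of_real (prob {\<omega> \<in> space M. x N \<omega> \<in> V}) * indicator U (?R \<omega>))"
  proof (rule fourier_uniqueness_PiM[of "{..N}"])
    show "integrable M (\<lambda>\<omega>. indicator V (x N \<omega>) :: complex)"
      by (rule integrable_const_bound[where B=1]) (auto simp: indicator_def)
    show "(CLINT \<omega>|M. indicator V (x N \<omega>) * iexp (\<Sum>k\<le>N. u k \<bullet> ?R \<omega> k)) =
      (CLINT \<omega>|M. complex_of_real (prob {\<omega> \<in> space M. x N \<omega> \<in> V}) * iexp (\<Sum>k\<le>N. u k \<bullet> ?R \<omega> k))" for u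
      using step[of u] by (simp add: sample_path_def)
  qed (use U residual_path_measurable in \<open>simp_all add: path_space_def\<close>)
  then have "complex_of_real (prob {\<omega> \<in> space M. ?R \<omega> \<in> U \<and> x N \<omega> \<in> V}) =
      complex_of_real (prob {\<omega> \<in> space M. x N \<omega> \<in> V} * prob {\<omega> \<in> space M. ?R \<omega> \<in> U})"
    by (simp add: ind)
  then show ?thesis by (simp only: of_real_eq_iff mult.commute)
qed

section \<open>The conditional law as a kernel\<close>

definition shift :: "real^'n \<Rightarrow> (nat \<Rightarrow> real^'n) \<Rightarrow> nat \<Rightarrow> real^'n" where
  "shift y r = (\<lambda>k\<in>{..N}. r k + regression k *v y)"

text \<open>Joint measurability in \<open>y\<close> and the path is needed for
  \<open>pinned_law\<close> to be a measurable kernel and for the sets integrated over the product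
  law below.\<close>

lemma shift_measurable: "(\<lambda>(y, r). shift y r) \<in> borel \<Otimes>\<^sub>M path_space N \<rightarrow>\<^sub>M path_space N"
proof -
  have "(\<lambda>p. \<lambda>k\<in>{..N}. snd p k + regression k *v fst p) \<in> borel \<Otimes>\<^sub>M Pi\<^sub>M {..N} (\<lambda>_. borel) \<rightarrow>\<^sub>M Pi\<^sub>M {..N} (\<lambda>_. borel)"
  proof (rule measurable_restrict)
    fix k assume k: "k \<in> {..N}"
    have "(\<lambda>p. snd p k) \<in> borel_measurable (borel \<Otimes>\<^sub>M Pi\<^sub>M {..N} (\<lambda>_. borel))"
      by (rule measurable_compose[OF measurable_snd measurable_component_singleton[OF k]])
    moreover have "(\<lambda>p. regression k *v fst p) \<in> borel_measurable (borel \<Otimes>\<^sub>M Pi\<^sub>M {..N} (\<lambda>_. borel))"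
      by (intro measurable_compose[OF measurable_fst] borel_measurable_continuous_onI linear_continuous_on
          matrix_vector_mul_bounded_linear)
    ultimately show "(\<lambda>p. snd p k + regression k *v fst p) \<in> borel_measurable (borel \<Otimes>\<^sub>M Pi\<^sub>M {..N} (\<lambda>_. borel))"
      by (rule borel_measurable_add)
  qed
  then show ?thesis unfolding path_space_def shift_def case_prod_beta .
qed

lemma shift_measurable_section: "shift y \<in> path_space N \<rightarrow>\<^sub>M path_space N"
  using measurable_compose[OF measurable_Pair1' shift_measurable, of y] by simp

definition "pinned_law y = distr (distr M (path_space N) (sample_path N residual)) (path_space N) (shift y)"

lemma pinned_law_measurable: "pinned_law \<in> borel \<rightarrow>\<^sub>M prob_algebra (path_space N)"
  unfolding pinned_law_def[abs_def]
proof (rule measurable_distr_prob_space2[OF measurable_const shift_measurable])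
  show "distr M (path_space N) (sample_path N residual) \<in> space (prob_algebra (path_space N))"
    by (simp add: space_prob_algebra prob_space_distr residual_path_measurable)
qed

lemma shift_residual: "shift (x N \<omega>) (sample_path N residual \<omega>) = sample_path N x \<omega>"
  by (auto simp: shift_def sample_path_def residual_def restrict_def)

text \<open>By independence the residual path and the final state have a product law, and the sample
  path is their image under \<open>shift\<close>. Integrating the sections at fixed final state is
  the required disintegration.\<close>

lemma regular_conditional_law_pinned_law:
  "regular_conditional_law M (path_space N) (sample_path N x) borel (x N) pinned_law"
  unfolding regular_conditional_law_def
proof (intro conjI pinned_law_measurable ballI)
  fix U :: "(nat \<Rightarrow> real^'n) set" and V :: "(real^'n) set"
  assume U [measurable]: "U \<in> sets (path_space N)" and V [measurable]: "V \<in> sets borel"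
  let ?R = "sample_path N residual"
  let ?\<rho> = "distr M (path_space N) ?R" and ?\<nu> = "distr M borel (x N)"
  have [measurable]: "x N \<in> borel_measurable M" by (rule x_measurable) simp
  note [measurable] = residual_path_measurable
  interpret \<rho>: prob_space ?\<rho> by (rule prob_space_distr) measurable
  interpret \<nu>: prob_space ?\<nu> by (rule prob_space_distr) measurable
  interpret pair: pair_prob_space ?\<rho> ?\<nu> ..
  have pair: "?\<rho> \<Otimes>\<^sub>M ?\<nu> = distr M (path_space N \<Otimes>\<^sub>M borel) (\<lambda>\<omega>. (?R \<omega>, x N \<omega>))"
  proof (rule pair_measure_eqI)
    show "sigma_finite_measure ?\<rho>" "sigma_finite_measure ?\<nu>" ..
    fix U' V' assume "U' \<in> sets ?\<rho>" "V' \<in> sets ?\<nu>"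
    then have [measurable]: "U' \<in> sets (path_space N)" "V' \<in> sets borel" by simp_all
    have "emeasure ?\<rho> U' = ennreal (prob {\<omega> \<in> space M. ?R \<omega> \<in> U'})"
      "emeasure ?\<nu> V' = ennreal (prob {\<omega> \<in> space M. x N \<omega> \<in> V'})"
      by (simp_all add: emeasure_distr emeasure_eq_measure vimage_def Int_def conj_commute)
    moreover have "emeasure (distr M (path_space N \<Otimes>\<^sub>M borel) (\<lambda>\<omega>. (?R \<omega>, x N \<omega>))) (U' \<times> V') =
        ennreal (prob {\<omega> \<in> space M. ?R \<omega> \<in> U' \<and> x N \<omega> \<in> V'})"
      by (simp add: emeasure_distr emeasure_eq_measure vimage_def Int_def conj_commute)
    ultimately show "emeasure ?\<rho> U' * emeasure ?\<nu> V' =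
        emeasure (distr M (path_space N \<Otimes>\<^sub>M borel) (\<lambda>\<omega>. (?R \<omega>, x N \<omega>))) (U' \<times> V')"
      by (simp add: residual_independent ennreal_mult)
  qed (simp cong: sets_pair_measure_cong)
  define T where "T = {p \<in> space (path_space N \<Otimes>\<^sub>M borel). shift (snd p) (fst p) \<in> U \<and> snd p \<in> V}"
  have "(\<lambda>p. (\<lambda>(y, r). shift y r) (snd p, fst p)) \<in> path_space N \<Otimes>\<^sub>M borel \<rightarrow>\<^sub>M path_space N"
    by (rule measurable_compose[OF _ shift_measurable]) measurable
  then have [measurable]: "(\<lambda>p. shift (snd p) (fst p)) \<in> path_space N \<Otimes>\<^sub>M borel \<rightarrow>\<^sub>M path_space N" by simp
  have T [measurable]: "T \<in> sets (path_space N \<Otimes>\<^sub>M borel)" unfolding T_def by measurable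
  have R_space: "?R \<omega> \<in> space (path_space N)" if "\<omega> \<in> space M" for \<omega>
    using that measurable_space[OF residual_path_measurable] by blast
  have "{\<omega> \<in> space M. sample_path N x \<omega> \<in> U \<and> x N \<omega> \<in> V} = (\<lambda>\<omega>. (?R \<omega>, x N \<omega>)) -` T \<inter> space M"
    using R_space by (auto simp: T_def shift_residual space_pair_measure)
  then have "emeasure M {\<omega> \<in> space M. sample_path N x \<omega> \<in> U \<and> x N \<omega> \<in> V} = emeasure (?\<rho> \<Otimes>\<^sub>M ?\<nu>) T"
    unfolding pair by (simp add: emeasure_distr)
  also have "\<dots> = (\<integral>\<^sup>+y. emeasure ?\<rho> ((\<lambda>r. (r, y)) -` T) \<partial>?\<nu>)"
    by (rule pair.emeasure_pair_measure_alt2) simp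
  also have "\<dots> = (\<integral>\<^sup>+y. emeasure (pinned_law y) U * indicator V y \<partial>?\<nu>)"
  proof (rule nn_integral_cong)
    fix y
    have "(\<lambda>r. (r, y)) -` T = (if y \<in> V then shift y -` U \<inter> space (path_space N) else {})"
      by (auto simp: T_def space_pair_measure)
    then show "emeasure ?\<rho> ((\<lambda>r. (r, y)) -` T) = emeasure (pinned_law y) U * indicator V y"
      unfolding pinned_law_def by (simp add: emeasure_distr shift_measurable_section)
  qed
  finally show "emeasure M {\<omega> \<in> space M. sample_path N x \<omega> \<in> U \<and> x N \<omega> \<in> V} = (\<integral>\<^sup>+y\<in>V. emeasure (pinned_law y) U \<partial>?\<nu>)" .
qed

lemma joint_gaussian_law_pinned_law:
  "joint_gaussian_law {..N} (pinned_law y) (\<lambda>k. mean k + regression k *v (y - mean N))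
     (\<lambda>k l. free_cov k l - regression k ** free_cov N l)"
proof -
  \<comment> \<open>For fixed \<open>y\<close> the shifted residual is still affine in the noises,
    so its law is found for every single \<open>y\<close>, with no exceptional null set.\<close>
  define Z where "Z k \<omega> = residual k \<omega> + regression k *v y" for k \<omega>
  have "pinned_law y = distr M (path_space N) (shift y \<circ> sample_path N residual)"
    unfolding pinned_law_def by (rule distr_distr[OF shift_measurable_section residual_path_measurable])
  also have "shift y \<circ> sample_path N residual = sample_path N Z"
    by (auto simp: shift_def sample_path_def Z_def fun_eq_iff)
  finally have K: "pinned_law y = distr M (path_space N) (sample_path N Z)" .
  have "joint_gaussian_law {..N} (distr M (path_space N) (sample_path N Z))
      (\<lambda>k. mean k + regression k *v (y - mean N))
      (\<lambda>k l. \<Sum>j<N. residual_gain k j ** mat 1 ** transpose (residual_gain l j))"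
  proof (rule joint_gaussian_law_affine)
    fix k assume k: "k \<le> N"
    show "Z k \<in> borel_measurable M"
      unfolding Z_def by (intro borel_measurable_add residual_measurable[OF k] borel_measurable_const)
    show "AE \<omega> in M. Z k \<omega> = mean k + regression k *v (y - mean N) + (\<Sum>j<N. residual_gain k j *v w j \<omega>)"
      using residual_solution[OF k] by eventually_elim (simp add: Z_def matrix_vector_mult_diff_distrib)
  qed
  then show ?thesis unfolding K by (simp add: residual_cov)
qed

lemma gaussian_conditional_law_pinned_law: "gaussian_conditional_law M N x pinned_law"
  unfolding gaussian_conditional_law_def
proof (intro conjI regular_conditional_law_pinned_law allI)
  fix y
  show "joint_gaussian_law {..N} (pinned_law y)
        (\<lambda>k. integral\<^sup>L M (x k) +
             (cross_covariance M (x k) (x N) ** pseudo_inverse (cross_covariance M (x N) (x N)))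
               *v (y - integral\<^sup>L M (x N)))
        (\<lambda>k l. cross_covariance M (x k) (x l) -
             cross_covariance M (x k) (x N) ** pseudo_inverse (cross_covariance M (x N) (x N))
               ** cross_covariance M (x N) (x l))"
    by (rule joint_gaussian_law_cong[THEN iffD1, OF _ _ joint_gaussian_law_pinned_law])
       (simp_all add: regression_def expectation_x cross_covariance_x free_cov_final)
qed

text \<open>The two processes may live on different probability spaces with unrelated noises, so
  only laws can be compared. Both are joint Gaussian laws on path space with the same mean and
  covariances, hence equal.\<close>

lemma pinned_process_of_pinned_dynamics:
  assumes pinned: "pinned_dynamics M' N A B x0 y w' x'"
  shows "pinned_process N M x y M' x'"
proof -
  have M': "prob_space M'" and noise': "independent_gaussian_noise M' N (pinned_noise_cov A B N) w'"
    and meas: "\<And>k. k \<le> N \<Longrightarrow> x' k \<in> borel_measurable M'"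
    and init: "AE \<omega> in M'. x' 0 \<omega> = x0"
    and step: "\<And>k. k < N \<Longrightarrow> AE \<omega> in M'. x' (Suc k) \<omega> =
        A_hat A B N k *v x' k \<omega> + (B k ** pinned_gain A B N k) *v y + B k *v w' k \<omega>"
    using pinned unfolding pinned_dynamics_def by auto
  interpret M': gaussian_noise M' N "pinned_noise_cov A B N" w'
    using M' noise' by (simp add: gaussian_noise_def gaussian_noise_axioms_def)
  let ?K = "distr M' (path_space N) (sample_path N x')"
  have "joint_gaussian_law {..N} ?K (drift (A_hat A B N) (\<lambda>k. (B k ** pinned_gain A B N k) *v y) x0)
      (\<lambda>k l. \<Sum>j<N. noise_gain (A_hat A B N) B k j ** pinned_noise_cov A B N j
          ** transpose (noise_gain (A_hat A B N) B l j))"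
    by (rule M'.joint_gaussian_law_affine[OF meas recursion_solution[where x=x', OF init step]])
  then have "joint_gaussian_law {..N} ?K (\<lambda>k. mean k + regression k *v (y - mean N))
     (\<lambda>k l. free_cov k l - regression k ** free_cov N l)"
    by (rule joint_gaussian_law_cong[THEN iffD1, rotated 2])
       (simp_all add: pinned_drift_eq_conditional_mean pinned_cov_eq_conditional_cov)
  then have "?K = pinned_law y"
    using joint_gaussian_law_pinned_law by (rule joint_gaussian_law_unique[OF finite_atMost])
  then show ?thesis
    unfolding pinned_process_def using meas gaussian_conditional_law_pinned_law by auto
qed

end

text \<open>The first conjunct guarantees that the matrices prescribed for the pinned noise really
  are covariances, so the dynamics do not ask for an impossible Gaussian law.\<close>

theorem theorem2:
  fixes A :: "nat \<Rightarrow> real^'n^'n"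
    and B :: "nat \<Rightarrow> real^'m^'n"
    and N :: nat
    and x0 xN :: "real^'n"
  assumes "0 < N"
    and "\<forall>k<N. invertible (A k)"
    and "invertible (reach_gramian A B N 0)"
  shows "(\<forall>k<N. covariance_matrix (pinned_noise_cov A B N k)) \<and>
    (\<forall>(M :: 'a measure) w xt (M' :: 'b measure) wb xb.
       noise_driven M N A B x0 w xt \<longrightarrow>
       pinned_dynamics M' N A B x0 xN wb xb \<longrightarrow>
       pinned_process N M xt xN M' xb)"
proof -
  interpret reachable_system A B N using assms by unfold_locales auto
  have "pinned_process N M xt xN M' xb"
    if driven: "noise_driven M N A B x0 w xt" and pinned: "pinned_dynamics M' N A B x0 xN wb xb"
    for M :: "'a measure" and w xt and M' :: "'b measure" and wb xb
  proof -
    interpret prob_space M using driven by (simp add: noise_driven_def)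
    interpret driven_system A B N M w x0 xt
      by unfold_locales (use driven in \<open>auto simp: noise_driven_def\<close>)
    show ?thesis by (rule pinned_process_of_pinned_dynamics[OF pinned])
  qed
  then show ?thesis using covariance_matrix_pinned_noise_cov by blast
qed

end
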